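(* Let $G$ be a finite group. Then $G$ has dense solitary subgroups if and only if either $G$ is cyclic, or $G$ is (isomorphic to) a ZM-group ${\rm ZM}(m,n,r)$, where $m$ is prime, $d=o_m(r)$ is prime, and $n=d^{\alpha}p^{\beta}$ with $p$ prime, $p\neq d$, $\alpha\geq 1$ and $\beta\in\{0,1\}$.
   Context: A subgroup $H$ of a group $G$ is called a solitary subgroup of $G$ if $G$ does not contain another isomorphic copy of $H$, i.e. every subgroup of $G$ isomorphic to $H$ is equal to $H$. A group $G$ has dense solitary subgroups if for each pair $(H,K)$ of subgroups of $G$ such that $H<K$ (strict inclusion) and $H$ is not maximal in $K$, there exists a solitary subgroup $X$ of $G$ such that $H<X<K$ (both inclusions strict). A ZM-group is a finite non-abelian group with all Sylow subgroups cyclic. Every such group is of the form ${\rm ZM}(m,n,r)=\langle a,b \mid a^m=b^n=1,\ b^{-1}ab=a^r\rangle$, where $(m,n,r)$ is a triple of positive integers satisfying $\gcd(m,n)=\gcd(m,r-1)=1$ and $r^n\equiv 1 \pmod m$. These conditions on $(m,n,r)$ are always understood when writing ${\rm ZM}(m,n,r)$. $o_m(r)=\min\{k\in\mathbb{N},\ k\geq 1 \mid r^k\equiv 1 \pmod m\}$ denotes the multiplicative order of $r$ modulo $m$. *)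

theory Defs
  imports "HOL-Algebra.Algebra" "HOL-Number_Theory.Number_Theory"
begin

section \<open>Solitary subgroups\<close>

text \<open>Subgroups are subsets of the carrier, as in HOL-Algebra; the group structure on a subgroup
  \<open>H\<close> of \<open>G\<close> is \<open>G\<lparr>carrier := H\<rparr>\<close>.\<close>

definition solitary_subgroup :: "'a set \<Rightarrow> ('a, 'b) monoid_scheme \<Rightarrow> bool" where
  "solitary_subgroup H G \<longleftrightarrow>
     subgroup H G \<and>
     (\<forall>K. subgroup K G \<and> G\<lparr>carrier := K\<rparr> \<cong> G\<lparr>carrier := H\<rparr> \<longrightarrow> K = H)"

definition maximal_subgroup :: "'a set \<Rightarrow> ('a, 'b) monoid_scheme \<Rightarrow> bool" where
  "maximal_subgroup H K \<longleftrightarrow>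
     subgroup H K \<and> H \<noteq> carrier K \<and>
     (\<forall>L. subgroup L K \<and> H \<subseteq> L \<longrightarrow> L = H \<or> L = carrier K)"

definition dense_solitary_subgroups :: "('a, 'b) monoid_scheme \<Rightarrow> bool" where
  "dense_solitary_subgroups G \<longleftrightarrow>
     (\<forall>H K. subgroup H G \<and> subgroup K G \<and> H \<subset> K \<and> \<not> maximal_subgroup H (G\<lparr>carrier := K\<rparr>) \<longrightarrow>
        (\<exists>S. solitary_subgroup S G \<and> H \<subset> S \<and> S \<subset> K))"

section \<open>Groups given by generators and relations\<close>

text \<open>Words in the generators and their formal inverses: the letter \<open>(x, True)\<close> stands for \<open>x\<close>
  and \<open>(x, False)\<close> for its inverse.  A relation \<open>u = v\<close> is the pair \<open>(u, v)\<close>, and every element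
  of the type \<open>'g\<close> is a generator.\<close>

type_synonym 'g word = "('g \<times> bool) list"

text \<open>The smallest congruence on words that contains \<open>R\<close> and identifies \<open>x x\<^sup>-\<^sup>1\<close> and \<open>x\<^sup>-\<^sup>1 x\<close>
  with the empty word.\<close>

inductive word_eq :: "('g word \<times> 'g word) set \<Rightarrow> 'g word \<Rightarrow> 'g word \<Rightarrow> bool"
  for R :: "('g word \<times> 'g word) set" where
  refl: "word_eq R u u"
| sym: "word_eq R u v \<Longrightarrow> word_eq R v u"
| trans: "word_eq R u v \<Longrightarrow> word_eq R v w \<Longrightarrow> word_eq R u w"
| append: "word_eq R u u' \<Longrightarrow> word_eq R v v' \<Longrightarrow> word_eq R (u @ v) (u' @ v')"
| cancel: "word_eq R [(x, e), (x, \<not> e)] []"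
| relation: "(u, v) \<in> R \<Longrightarrow> word_eq R u v"

definition word_class :: "('g word \<times> 'g word) set \<Rightarrow> 'g word \<Rightarrow> 'g word set" where
  "word_class R u = {v. word_eq R u v}"

definition presented_group :: "('g word \<times> 'g word) set \<Rightarrow> 'g word set monoid" where
  "presented_group R =
     \<lparr>carrier = range (word_class R),
      monoid.mult = (\<lambda>A B. \<Union>u\<in>A. \<Union>v\<in>B. word_class R (u @ v)),
      one = word_class R []\<rparr>"

lemma word_class_eq_iff: "word_class R u = word_class R v \<longleftrightarrow> word_eq R u v"
proof
  assume "word_class R u = word_class R v"
  then have "v \<in> word_class R u"
    by (simp add: word_class_def word_eq.refl)
  then show "word_eq R u v"
    by (simp add: word_class_def)
next
  assume uv: "word_eq R u v"
  show "word_class R u = word_class R v"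
    unfolding word_class_def
    using word_eq.trans[OF uv] word_eq.trans[OF word_eq.sym[OF uv]] by blast
qed

lemma mult_presented_group:
  "word_class R u \<otimes>\<^bsub>presented_group R\<^esub> word_class R v = word_class R (u @ v)"
proof -
  have "word_class R (u' @ v') = word_class R (u @ v)"
    if "u' \<in> word_class R u" "v' \<in> word_class R v" for u' v'
  proof -
    have "word_eq R (u @ v) (u' @ v')"
      using that by (simp add: word_class_def word_eq.append)
    then show ?thesis
      by (simp add: word_class_eq_iff word_eq.sym)
  qed
  moreover have "u \<in> word_class R u" "v \<in> word_class R v"
    by (simp_all add: word_class_def word_eq.refl)
  ultimately have "(\<Union>u'\<in>word_class R u. \<Union>v'\<in>word_class R v. word_class R (u' @ v'))
      = word_class R (u @ v)"
    by blast
  then show ?thesis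
    by (simp add: presented_group_def)
qed

lemma word_eq_inverse:
  "word_eq R (rev (map (\<lambda>(x, e). (x, \<not> e)) u) @ u) []"
proof (induction u)
  case Nil
  show ?case by (simp add: word_eq.refl)
next
  case (Cons l u)
  obtain x e where l: "l = (x, e)" by fastforce
  let ?u' = "rev (map (\<lambda>(x, e). (x, \<not> e)) u)"
  have "word_eq R [(x, \<not> e), (x, e)] []"
    using word_eq.cancel[of R x "\<not> e"] by simp
  then have "word_eq R (?u' @ ([(x, \<not> e), (x, e)] @ u)) (?u' @ ([] @ u))"
    by (intro word_eq.append word_eq.refl)
  then show ?case
    using word_eq.trans[OF _ Cons.IH] l by simp
qed

lemma group_presented_group: "group (presented_group R)"
proof (rule groupI)
  fix A B C
  assume A: "A \<in> carrier (presented_group R)"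
  then obtain u where u: "A = word_class R u"
    by (auto simp: presented_group_def)
  have one: "\<one>\<^bsub>presented_group R\<^esub> = word_class R []"
    by (simp add: presented_group_def)
  show "\<one>\<^bsub>presented_group R\<^esub> \<otimes>\<^bsub>presented_group R\<^esub> A = A"
    by (simp add: u one mult_presented_group)
  have "word_class R (rev (map (\<lambda>(x, e). (x, \<not> e)) u)) \<otimes>\<^bsub>presented_group R\<^esub> A
      = \<one>\<^bsub>presented_group R\<^esub>"
    by (simp only: u one mult_presented_group word_class_eq_iff word_eq_inverse)
  then show "\<exists>B\<in>carrier (presented_group R). B \<otimes>\<^bsub>presented_group R\<^esub> A = \<one>\<^bsub>presented_group R\<^esub>"
    by (auto simp: presented_group_def)
  assume B: "B \<in> carrier (presented_group R)"
  then obtain v where v: "B = word_class R v"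
    by (auto simp: presented_group_def)
  have "A \<otimes>\<^bsub>presented_group R\<^esub> B = word_class R (u @ v)"
    by (simp add: u v mult_presented_group)
  then show "A \<otimes>\<^bsub>presented_group R\<^esub> B \<in> carrier (presented_group R)"
    by (simp add: presented_group_def)
  assume "C \<in> carrier (presented_group R)"
  then obtain w where "C = word_class R w"
    by (auto simp: presented_group_def)
  then show "A \<otimes>\<^bsub>presented_group R\<^esub> B \<otimes>\<^bsub>presented_group R\<^esub> C
      = A \<otimes>\<^bsub>presented_group R\<^esub> (B \<otimes>\<^bsub>presented_group R\<^esub> C)"
    by (simp add: u v mult_presented_group)
qed (auto simp: presented_group_def)

section \<open>The groups \<open>ZM(m,n,r)\<close>\<close>

datatype ZM_gen = Gen_a | Gen_b

definition ZM_relations :: "nat \<Rightarrow> nat \<Rightarrow> nat \<Rightarrow> (ZM_gen word \<times> ZM_gen word) set" where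
  "ZM_relations m n r =
     {(replicate m (Gen_a, True), []),
      (replicate n (Gen_b, True), []),
      ([(Gen_b, False), (Gen_a, True), (Gen_b, True)], replicate r (Gen_a, True))}"

definition ZM :: "nat \<Rightarrow> nat \<Rightarrow> nat \<Rightarrow> ZM_gen word set monoid" where
  "ZM m n r = presented_group (ZM_relations m n r)"

text \<open>The standing conditions on the parameters.  As \<open>r > 0\<close>, the subtraction \<open>r - 1\<close> does not
  truncate.\<close>

definition ZM_triple :: "nat \<Rightarrow> nat \<Rightarrow> nat \<Rightarrow> bool" where
  "ZM_triple m n r \<longleftrightarrow>
     m > 0 \<and> n > 0 \<and> r > 0 \<and> gcd m n = 1 \<and> gcd m (r - 1) = 1 \<and> [r ^ n = 1] (mod m)"

end

(*
  Let G have dense solitary subgroups. Solitary subgroups are characteristic, and refining a chain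
  of solitary subgroups below H produces a solitary subgroup of prime index in H; for a p-subgroup H
  this forces every proper subgroup of H into one chain, so H is cyclic. If all Sylow subgroups are
  normal, G is therefore cyclic. Otherwise let D be a non-normal Sylow d-subgroup with d maximal, and
  N its normalizer. Subgroups above N are self-normalizing and those between D and N contain D as a
  characteristic subgroup, so none of them is solitary. Density then makes N maximal of prime index q
  and makes D equal to N or maximal in N, whence |G| = q d^alpha p^beta with beta <= 1. As q = 1 mod d
  exceeds d, the Sylow q-subgroup is normal, and density once more shows that N is cyclic and that
  its subgroup of index d is normal, hence centralizes the Sylow q-subgroup.

  Conversely, in ZM(q, n, r) the subgroups containing <a> and the subgroups of the center <b^d>
  are solitary, and they separate any H < K with H not maximal in K. If K contains <a> but H does not,
  take H<a>; if K does not contain <a> and H is central, take the intersection of K with the center.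
  If neither contains <a> and H is not central, the full power of d divides |H|, so |K : H| divides
  p and H is maximal in K; this is where beta <= 1 enters.
*)
theory Submission
  imports Defs
begin

section \<open>Subgroups of finite groups\<close>

text \<open>In the forward direction solitary subgroups act almost only as normal subgroups: beyond
  normality, the absence of a second isomorphic copy is used once, to show that subgroups of prime
  power order are cyclic. In the converse, isomorphism enters only through the order: a subgroup
  that contains \<open>a\<close>, or that lies in the group generated by \<open>b^d\<close>, is
  determined by its order. The obstacle on the way to ZM(q,n,r) is coprimality. Density first yields
  |G| = q d^\<alpha> s with s equal to 1 or a prime, and nothing yet prevents s = q or a non-normal
  Sylow s-subgroup. Both cases are refuted before G can be split into a normal subgroup of order q
  and a cyclic complement of order d^\<alpha> s; their generators are the \<open>a\<close> and
  \<open>b\<close> of the presentation. Conjugacy of Sylow subgroups and the congruence q = 1 mod d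
  both rest on one divisibility statement about double cosets.\<close>

context group
begin

lemma maximal_subgroup_iff:
  assumes H: "subgroup H G" and K: "subgroup K G" and HK: "H \<subset> K"
  shows "maximal_subgroup H (G\<lparr>carrier := K\<rparr>) \<longleftrightarrow>
    (\<forall>L. subgroup L G \<longrightarrow> H \<subseteq> L \<longrightarrow> L \<subseteq> K \<longrightarrow> L = H \<or> L = K)"
proof -
  have "subgroup L (G\<lparr>carrier := K\<rparr>) \<longleftrightarrow> subgroup L G \<and> L \<subseteq> K" for L
    using incl_subgroup[OF K] subgroup_incl[OF _ K] subgroup.subset[of L "G\<lparr>carrier := K\<rparr>"]
    by auto
  with H HK show ?thesis
    unfolding maximal_subgroup_def by auto
qed

lemma pow_gcd_mem:
  fixes a b :: nat
  assumes H: "subgroup H G" and z: "z \<in> carrier G" and "z [^] a \<in> H" "z [^] b \<in> H"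
  shows "z [^] gcd a b \<in> H"
proof -
  obtain u v where uv: "u * int a + v * int b = gcd (int a) (int b)"
    using bezout_int by blast
  have "z [^] gcd a b = z [^] (int a * u + int b * v)"
    using uv by (simp add: mult.commute int_pow_int[symmetric])
  also have "\<dots> = (z [^] a) [^] u \<otimes> (z [^] b) [^] v"
    using z by (simp add: int_pow_mult int_pow_pow[symmetric] int_pow_int)
  also have "\<dots> \<in> H"
    using assms by (intro subgroup.m_closed[OF H] subgroup_int_pow_closed)
  finally show ?thesis .
qed

lemma pow_coprime_mem:
  fixes a b :: nat
  assumes "subgroup H G" "z \<in> carrier G" "z [^] a \<in> H" "z [^] b \<in> H" "coprime a b"
  shows "z \<in> H"
  using pow_gcd_mem[OF assms(1-4)] assms by simp

lemma subgroup_nat_pow_closed: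
  assumes "subgroup H G" "h \<in> H"
  shows "h [^] (k :: nat) \<in> H"
  using subgroup_int_pow_closed[OF assms, of "int k"] by (simp add: int_pow_int)

lemma generate_singleton_subset:
  assumes "subgroup H G" "x \<in> H"
  shows "generate G {x} \<subseteq> H"
  using generate_subgroup_incl[of "{x}" H] assms by simp

lemma generate_singleton_subgroup:
  assumes "x \<in> carrier G"
  shows "subgroup (generate G {x}) G"
  using generate_is_subgroup[of "{x}"] assms by simp

lemma generate_singleton_self:
  "x \<in> generate G {x}"
  by (rule generate.incl) simp

text \<open>The map sends \<open>x^i\<close> to \<open>y^i\<close>. It is well defined and injective
  because, for either generator, equality of powers depends only on the exponents modulo the common
  order; so the exponent picked by \<open>f\<close> does not matter.\<close>

lemma iso_cyclic_subgroups:
  assumes x: "x \<in> carrier G" and y: "y \<in> carrier G" and o: "ord x = ord y"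
  shows "G\<lparr>carrier := generate G {x}\<rparr> \<cong> G\<lparr>carrier := generate G {y}\<rparr>"
proof -
  define f where "f z = y [^] (SOME i::int. z = x [^] i)" for z
  have f: "f (x [^] i) = y [^] i" for i :: int
  proof -
    have "x [^] i = x [^] (SOME j::int. x [^] i = x [^] j)"
      by (rule someI_ex) auto
    then show ?thesis
      unfolding f_def using x y o by (metis int_pow_eq)
  qed
  have "f \<in> iso (G\<lparr>carrier := generate G {x}\<rparr>) (G\<lparr>carrier := generate G {y}\<rparr>)"
  proof (rule isoI)
    show "f \<in> hom (G\<lparr>carrier := generate G {x}\<rparr>) (G\<lparr>carrier := generate G {y}\<rparr>)"
    proof (rule homI)
      fix u v assume u: "u \<in> carrier (G\<lparr>carrier := generate G {x}\<rparr>)"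
      then obtain i :: int where i: "u = x [^] i"
        using generate_pow[OF x] by auto
      then show "f u \<in> carrier (G\<lparr>carrier := generate G {y}\<rparr>)"
        using generate_pow[OF y] f by auto
      assume v: "v \<in> carrier (G\<lparr>carrier := generate G {x}\<rparr>)"
      then obtain j :: int where j: "v = x [^] j"
        using generate_pow[OF x] by auto
      show "f (u \<otimes>\<^bsub>G\<lparr>carrier := generate G {x}\<rparr>\<^esub> v) = f u \<otimes>\<^bsub>G\<lparr>carrier := generate G {y}\<rparr>\<^esub> f v"
        using i j f x y by (simp add: int_pow_mult[symmetric])
    qed
    show "bij_betw f (carrier (G\<lparr>carrier := generate G {x}\<rparr>)) (carrier (G\<lparr>carrier := generate G {y}\<rparr>))"
    proof (rule bij_betwI')
      fix u v
      assume "u \<in> carrier (G\<lparr>carrier := generate G {x}\<rparr>)" "v \<in> carrier (G\<lparr>carrier := generate G {x}\<rparr>)"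
      then obtain i j :: int where ij: "u = x [^] i" "v = x [^] j"
        using generate_pow[OF x] by auto
      show "(f u = f v) = (u = v)"
        using x y o unfolding ij f by (simp add: int_pow_eq)
    next
      fix u
      assume "u \<in> carrier (G\<lparr>carrier := generate G {x}\<rparr>)"
      then show "f u \<in> carrier (G\<lparr>carrier := generate G {y}\<rparr>)"
        using generate_pow[OF y] generate_pow[OF x] f by auto
    next
      fix w
      assume "w \<in> carrier (G\<lparr>carrier := generate G {y}\<rparr>)"
      then show "\<exists>u\<in>carrier (G\<lparr>carrier := generate G {x}\<rparr>). w = f u"
        using generate_pow[OF y] generate_pow[OF x] f by force
    qed
  qed
  then show ?thesis by (rule is_isoI)
qed

lemma conj_subgroup:
  assumes H: "subgroup H G" and g: "g \<in> carrier G"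
  shows "subgroup ((\<lambda>x. g \<otimes> x \<otimes> inv g) ` H) G"
    and "G\<lparr>carrier := (\<lambda>x. g \<otimes> x \<otimes> inv g) ` H\<rparr> \<cong> G\<lparr>carrier := H\<rparr>"
    and "card ((\<lambda>x. g \<otimes> x \<otimes> inv g) ` H) = card H"
proof -
  let ?c = "\<lambda>x. g \<otimes> x \<otimes> inv g"
  have hom: "?c \<in> hom G G"
  proof (rule homI)
    fix x y assume xy: "x \<in> carrier G" "y \<in> carrier G"
    then show "?c x \<in> carrier G" using g by simp
    have "?c x \<otimes> ?c y = g \<otimes> x \<otimes> (inv g \<otimes> g) \<otimes> y \<otimes> inv g"
      using xy g by (simp only: m_assoc m_closed inv_closed)
    also have "\<dots> = ?c (x \<otimes> y)"
      using xy g by (simp add: m_assoc)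
    finally show "?c (x \<otimes> y) = ?c x \<otimes> ?c y" ..
  qed
  then interpret group_hom G G ?c
    by (unfold_locales)
  show *: "subgroup (?c ` H) G"
    by (rule subgroup_img_is_subgroup[OF H])
  have inj: "inj_on ?c H"
    using g subgroup.mem_carrier[OF H] by (auto simp: inj_on_def)
  have "?c \<in> iso (G\<lparr>carrier := H\<rparr>) (G\<lparr>carrier := ?c ` H\<rparr>)"
    using inj hom subgroup.mem_carrier[OF H] by (auto simp: iso_def hom_def bij_betw_def)
  then show "G\<lparr>carrier := ?c ` H\<rparr> \<cong> G\<lparr>carrier := H\<rparr>"
    using group.iso_sym[OF subgroup_imp_group[OF H]] is_isoI by blast
  show "card (?c ` H) = card H"
    by (rule card_image[OF inj])
qed

lemma solitary_subgroup_imp_subgroup: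
  "solitary_subgroup S G \<Longrightarrow> subgroup S G"
  by (simp add: solitary_subgroup_def)

lemma solitary_imp_normal:
  assumes S: "solitary_subgroup S G"
  shows "S \<lhd> G"
  unfolding normal_inv_iff
proof (intro conjI ballI)
  show sub: "subgroup S G" using S by (rule solitary_subgroup_imp_subgroup)
  fix g x assume "g \<in> carrier G" "x \<in> S"
  with S conj_subgroup[OF sub, of g] show "g \<otimes> x \<otimes> inv g \<in> S"
    unfolding solitary_subgroup_def by blast
qed

lemma solitary_carrier:
  assumes "finite (carrier G)"
  shows "solitary_subgroup (carrier G) G"
  unfolding solitary_subgroup_def
proof (intro conjI allI impI)
  fix K assume "subgroup K G \<and> G\<lparr>carrier := K\<rparr> \<cong> G\<lparr>carrier := carrier G\<rparr>"
  then show "K = carrier G"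
    using iso_same_card[of "G\<lparr>carrier := K\<rparr>" "G\<lparr>carrier := carrier G\<rparr>"] assms
      card_subset_eq[OF assms, of K] subgroup.subset[of K G] by simp
qed (rule subgroup_self)

lemma solitary_one: "solitary_subgroup {\<one>} G"
  unfolding solitary_subgroup_def
proof (intro conjI allI impI)
  fix K assume K: "subgroup K G \<and> G\<lparr>carrier := K\<rparr> \<cong> G\<lparr>carrier := {\<one>}\<rparr>"
  then have "card K = 1"
    using iso_same_card[of "G\<lparr>carrier := K\<rparr>" "G\<lparr>carrier := {\<one>}\<rparr>"] by simp
  then show "K = {\<one>}"
    using K subgroup.one_closed by (metis card_1_singletonE singletonD)
qed (rule triv_subgroup)

text \<open>An element with the order of \<open>x\<close> generates an isomorphic copy, hence the
  same subgroup. This is the one consequence of solitarity beyond normality that the forward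
  direction draws.\<close>

lemma solitary_cyclic_mem:
  assumes S: "solitary_subgroup (generate G {x}) G"
    and x: "x \<in> carrier G" and y: "y \<in> carrier G" and o: "ord y = ord x"
  shows "y \<in> generate G {x}"
proof -
  have "generate G {y} = generate G {x}"
    using S iso_cyclic_subgroups[OF y x o] generate_singleton_subgroup[OF y]
    unfolding solitary_subgroup_def by blast
  then show ?thesis
    using generate_singleton_self by blast
qed

end

section \<open>Orders of subgroups and of elements in finite groups\<close>

locale finite_group = group +
  assumes fin [simp]: "finite (carrier G)"
begin

lemma finite_subgroup [simp]: "subgroup H G \<Longrightarrow> finite H"
  using finite_subset[OF subgroup.subset fin] by blast

lemma card_subgroup_pos: "subgroup H G \<Longrightarrow> card H > 0"
  using subgroup.one_closed[of H G] finite_subgroup[of H] card_gt_0_iff by blast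

lemma card_subgroup_dvd:
  assumes H: "subgroup H G" and K: "subgroup K G" and "H \<subseteq> K"
  shows "card H dvd card K"
proof -
  interpret K: group "G\<lparr>carrier := K\<rparr>"
    using K by (rule subgroup_imp_group)
  have "subgroup H (G\<lparr>carrier := K\<rparr>)"
    using assms subgroup_incl by blast
  from K.lagrange[OF this] have "card (rcosets\<^bsub>G\<lparr>carrier := K\<rparr>\<^esub> H) * card H = card K"
    by (simp add: order_def)
  then show ?thesis
    by (metis dvd_triv_right)
qed

lemma subgroup_eqI:
  assumes "subgroup K G" "H \<subseteq> K" "card K \<le> card H"
  shows "H = K"
  using assms card_seteq finite_subgroup by blast

lemma Int_coprime:
  assumes H: "subgroup H G" and K: "subgroup K G" and "coprime (card H) (card K)"
  shows "H \<inter> K = {\<one>}"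
proof -
  have "card (H \<inter> K) dvd 1"
    using card_subgroup_dvd[OF subgroups_Inter_pair[OF H K]] assms
    by (metis H K coprime_common_divisor_nat inf_le1 inf_le2 nat_dvd_1_iff_1)
  then have "card (H \<inter> K) = 1" by simp
  then show ?thesis
    using subgroup.one_closed[OF subgroups_Inter_pair[OF H K]] by (metis card_1_singletonE singletonD)
qed

lemma exists_prime_power_subgroup:
  assumes H: "subgroup H G" and p: "Factorial_Ring.prime p" and d: "p ^ a dvd card H"
  obtains P where "subgroup P G" "P \<subseteq> H" "card P = p ^ a"
proof -
  obtain m where "card H = p ^ a * m" using d by blast
  then have "\<exists>P. subgroup P (G\<lparr>carrier := H\<rparr>) \<and> card P = p ^ a"
    using p H by (intro sylow_thm subgroup_imp_group) (auto simp: order_def)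
  then show ?thesis
    using that incl_subgroup[OF H] subgroup.subset by fastforce
qed

lemma card_generate: "x \<in> carrier G \<Longrightarrow> card (generate G {x}) = ord x"
  by (simp add: generate_pow_card)

lemma ord_pos: "x \<in> carrier G \<Longrightarrow> ord x > 0"
  using ord_ge_1[OF fin] by (simp add: Suc_le_eq)

lemma generate_singleton: "x \<in> carrier G \<Longrightarrow> generate G {x} = {x [^] (i::nat) |i. True}"
  using generate_pow_on_finite_carrier[OF fin] by auto

lemma ord_dvd_card:
  assumes H: "subgroup H G" and x: "x \<in> H"
  shows "ord x dvd card H"
  using card_subgroup_dvd[OF generate_singleton_subgroup H generate_singleton_subset[OF H x]]
    card_generate subgroup.mem_carrier[OF H x] by simp

lemma pow_card_eq_one:
  assumes H: "subgroup H G" and x: "x \<in> H"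
  shows "x [^] card H = \<one>"
  using ord_dvd_card[OF assms] pow_eq_id subgroup.mem_carrier[OF H x] by simp

text \<open>With \<open>y = x^j\<close>, the order of \<open>x\<close> divides \<open>j * k\<close>,
  so \<open>j\<close> is a multiple of \<open>ord x div k\<close>.\<close>

lemma cyclic_root_mem:
  assumes x: "x \<in> carrier G" and y: "y \<in> generate G {x}"
    and k: "k dvd ord x" and 1: "y [^] k = \<one>"
  shows "y \<in> generate G {x [^] (ord x div k)}"
proof -
  obtain j where j: "y = x [^] (j::nat)"
    using y generate_singleton[OF x] by auto
  have "ord x dvd j * k"
    using 1 x unfolding j by (simp add: nat_pow_pow pow_eq_id)
  then have "ord x div k dvd j"
    using k ord_pos[OF x] by (auto elim!: dvdE)
  then obtain i where "j = (ord x div k) * i" by blast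
  then have "y = (x [^] (ord x div k)) [^] i"
    unfolding j using x by (simp add: nat_pow_pow)
  then show ?thesis
    using generate_singleton[of "x [^] (ord x div k)"] x by auto
qed

text \<open>Both subgroups consist of solutions of \<open>z^k = 1\<close> for
  \<open>k = card H\<close>. These lie in the subgroup generated by \<open>x^(ord x div k)\<close>,
  which has exactly \<open>k\<close> elements.\<close>

lemma cyclic_subgroup_unique:
  assumes x: "x \<in> carrier G" and H: "subgroup H G" "H \<subseteq> generate G {x}"
    and K: "subgroup K G" "K \<subseteq> generate G {x}" and c: "card H = card K"
  shows "H = K"
proof -
  let ?k = "card H"
  let ?y = "x [^] (ord x div ?k)"
  have k: "?k dvd ord x"
    using card_subgroup_dvd[OF H(1) generate_singleton_subgroup[OF x] H(2)] card_generate[OF x] by simp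
  have k0: "?k > 0" by (rule card_subgroup_pos[OF H(1)])
  have "ord x div ?k dvd ord x" "ord x div ?k \<noteq> 0"
    using k ord_pos[OF x] by auto
  then have "card (generate G {?y}) = ?k"
    using card_generate[of ?y] x ord_pow[OF x] k ord_pos[OF x] by auto
  moreover have "L \<subseteq> generate G {?y}" if "subgroup L G" "L \<subseteq> generate G {x}" "card L = ?k" for L
    using cyclic_root_mem[OF x _ k] that pow_card_eq_one[of L] by fastforce
  moreover have "subgroup (generate G {?y}) G"
    using x by (intro generate_singleton_subgroup) simp
  ultimately show ?thesis
    using H K c subgroup_eqI by (metis order_refl)
qed

text \<open>The quotient has order \<open>k\<close>, so \<open>x^k\<close> lies in \<open>N\<close>,
  and so does \<open>x^j = \<one>\<close>; Bezout gives \<open>x\<close> itself. For elements of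
  prime power order this says that a normal Sylow subgroup contains them all.\<close>

lemma normal_coprime_mem:
  assumes N: "N \<lhd> G" and x: "x \<in> carrier G" "x [^] (j::nat) = \<one>"
    and k: "card (carrier G) = card N * k" "coprime j k"
  shows "x \<in> N"
proof -
  interpret N: normal N G by fact
  interpret Q: group "G Mod N" by (rule N.factorgroup_is_group)
  have sub: "subgroup N G" by (rule normal_imp_subgroup[OF N])
  have "order (G Mod N) * card N = card (carrier G)"
    using lagrange[OF sub] by (simp add: order_def FactGroup_def)
  then have ord: "order (G Mod N) = k"
    using k card_subgroup_pos[OF sub] by auto
  have "(N #> x) [^]\<^bsub>G Mod N\<^esub> k = \<one>\<^bsub>G Mod N\<^esub>"
    using Q.pow_order_eq_1[of "N #> x"] x ord by (auto simp: carrier_FactGroup)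
  then have "N #> (x [^] k) = N"
    using x N.FactGroup_pow by simp
  then have "x [^] k \<in> N"
    using x sub rcos_self by blast
  then show ?thesis
    using pow_coprime_mem[OF sub x(1), of j k] x k subgroup.one_closed[OF sub] by simp
qed

lemma card_set_mult:
  assumes H: "subgroup H G" and K: "subgroup K G"
  shows "card (H <#> K) * card (H \<inter> K) = card H * card K"
proof -
  \<comment> \<open>a fixed factorization \<open>w = r\<^sub>1 r\<^sub>2\<close>; all others are \<open>(r\<^sub>1 x)(x\<^sup>-\<^sup>1 r\<^sub>2)\<close> with \<open>x \<in> H \<inter> K\<close>\<close>
  define r where "r w = (SOME p. p \<in> H \<times> K \<and> w = fst p \<otimes> snd p)" for w
  have r: "r w \<in> H \<times> K" "fst (r w) \<otimes> snd (r w) = w" if "w \<in> H <#> K" for w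
  proof -
    have "\<exists>p. p \<in> H \<times> K \<and> w = fst p \<otimes> snd p"
      using that by (auto simp: set_mult_def)
    from someI_ex[OF this] show "r w \<in> H \<times> K" "fst (r w) \<otimes> snd (r w) = w"
      unfolding r_def by auto
  qed
  define f where "f = (\<lambda>(w, x). (fst (r w) \<otimes> x, inv x \<otimes> snd (r w)))"
  note Hc = subgroup.mem_carrier[OF H] and Kc = subgroup.mem_carrier[OF K]
  have prod: "fst (f (w, x)) \<otimes> snd (f (w, x)) = w" if "w \<in> H <#> K" "x \<in> H \<inter> K" for w x
  proof -
    have c: "fst (r w) \<in> carrier G" "snd (r w) \<in> carrier G" "x \<in> carrier G"
      using r(1)[OF that(1)] that Hc Kc by (auto simp: mem_Times_iff)
    then have "fst (f (w, x)) \<otimes> snd (f (w, x)) = fst (r w) \<otimes> (x \<otimes> inv x) \<otimes> snd (r w)"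
      by (simp only: f_def prod.case fst_conv snd_conv m_assoc m_closed inv_closed)
    then show ?thesis using c r(2)[OF that(1)] by simp
  qed
  have "bij_betw f ((H <#> K) \<times> (H \<inter> K)) (H \<times> K)"
  proof (rule bij_betw_imageI)
    show "inj_on f ((H <#> K) \<times> (H \<inter> K))"
    proof (rule inj_onI, clarify)
      fix w x w' x'
      assume w: "w \<in> H <#> K" "w' \<in> H <#> K" and x: "x \<in> H" "x \<in> K" "x' \<in> H" "x' \<in> K"
        and eq: "f (w, x) = f (w', x')"
      have "w = w'"
        using prod[of w x] prod[of w' x'] w x eq by simp
      moreover have "fst (r w) \<in> carrier G"
        using r(1)[OF w(1)] Hc by (auto simp: mem_Times_iff)
      ultimately show "w = w' \<and> x = x'"
        using eq x Hc by (simp add: f_def)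
    qed
    show "f ` ((H <#> K) \<times> (H \<inter> K)) = H \<times> K"
    proof (intro equalityI subsetI)
      fix p assume "p \<in> f ` ((H <#> K) \<times> (H \<inter> K))"
      then show "p \<in> H \<times> K"
        using r(1) subgroup.m_closed[OF H] subgroup.m_closed[OF K] subgroup.m_inv_closed[OF K]
        by (fastforce simp: f_def mem_Times_iff)
    next
      fix p assume "p \<in> H \<times> K"
      then obtain h k where p: "p = (h, k)" "h \<in> H" "k \<in> K" by blast
      define w where "w = h \<otimes> k"
      have w: "w \<in> H <#> K" using p by (auto simp: set_mult_def w_def)
      obtain h' k' where hk: "r w = (h', k')" "h' \<in> H" "k' \<in> K"
        using r(1)[OF w] by (metis mem_Times_iff prod.collapse)
      have eq: "h' \<otimes> k' = h \<otimes> k" using r(2)[OF w] hk by (simp add: w_def)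
      define x where "x = inv h' \<otimes> h"
      have c: "h \<in> carrier G" "k \<in> carrier G" "h' \<in> carrier G" "k' \<in> carrier G"
        using p hk Hc Kc by auto
      have "inv h' \<otimes> h \<otimes> k = inv h' \<otimes> (h' \<otimes> k')"
        using c by (simp add: eq m_assoc)
      also have "\<dots> = k'"
        using c by (simp flip: m_assoc)
      finally have "inv h' \<otimes> h \<otimes> k = k'" .
      then have x': "x = k' \<otimes> inv k"
        using c by (metis inv_closed inv_solve_right' m_closed x_def)
      have "x \<in> H" using p hk H by (simp add: x_def subgroup.m_closed subgroup.m_inv_closed)
      moreover have "x \<in> K" using p hk K by (simp add: x' subgroup.m_closed subgroup.m_inv_closed)
      moreover have "f (w, x) = p"
      proof -
        have "h' \<otimes> x = h" using c by (simp add: x_def flip: m_assoc)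
        moreover have "inv x \<otimes> k' = k" using c by (simp add: x' inv_mult_group m_assoc)
        ultimately show ?thesis by (simp add: f_def hk p)
      qed
      ultimately show "p \<in> f ` ((H <#> K) \<times> (H \<inter> K))"
        using w by (metis (no_types, lifting) IntI image_eqI mem_Sigma_iff)
    qed
  qed
  then show ?thesis
    by (metis bij_betw_same_card card_cartesian_product)
qed

end

section \<open>Products of subgroups and normal subgroups of prime index\<close>

context group
begin

lemma set_mult_subgroup:
  assumes N: "subgroup N G" and H: "subgroup H G"
    and conj: "\<And>h x. h \<in> H \<Longrightarrow> x \<in> N \<Longrightarrow> h \<otimes> x \<otimes> inv h \<in> N"
  shows "subgroup (N <#> H) G"
proof (rule subgroupI)
  note Nc = subgroup.mem_carrier[OF N] and Hc = subgroup.mem_carrier[OF H]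
  show "N <#> H \<subseteq> carrier G" "N <#> H \<noteq> {}"
    using Nc Hc subgroup.one_closed[OF N] subgroup.one_closed[OF H] by (auto simp: set_mult_def)
  fix u assume "u \<in> N <#> H"
  then obtain x h where u: "u = x \<otimes> h" "x \<in> N" "h \<in> H" by (auto simp: set_mult_def)
  have "inv h \<otimes> inv x \<otimes> inv (inv h) \<in> N"
    using u N H by (intro conj subgroup.m_inv_closed)
  moreover have "inv u = (inv h \<otimes> inv x \<otimes> inv (inv h)) \<otimes> inv h"
    using u Nc Hc by (simp add: inv_mult_group m_assoc)
  ultimately show "inv u \<in> N <#> H"
    using u subgroup.m_inv_closed[OF H] by (auto simp: set_mult_def)
  fix v assume "v \<in> N <#> H"
  then obtain y k where v: "v = y \<otimes> k" "y \<in> N" "k \<in> H" by (auto simp: set_mult_def)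
  have "x \<otimes> (h \<otimes> y \<otimes> inv h) \<in> N" "h \<otimes> k \<in> H"
    using u v N H by (auto intro!: conj subgroup.m_closed)
  moreover have "u \<otimes> v = (x \<otimes> (h \<otimes> y \<otimes> inv h)) \<otimes> (h \<otimes> k)"
    using u v Nc Hc by (simp add: m_assoc) (simp flip: m_assoc)
  ultimately show "u \<otimes> v \<in> N <#> H"
    by (auto simp: set_mult_def)
qed

lemma set_mult_upper:
  assumes N: "subgroup N G" and H: "subgroup H G"
  shows "N \<subseteq> N <#> H" "H \<subseteq> N <#> H"
proof -
  show "N \<subseteq> N <#> H"
  proof
    fix x assume x: "x \<in> N"
    then have "x = x \<otimes> \<one>" using subgroup.mem_carrier[OF N] by simp
    then show "x \<in> N <#> H" using x subgroup.one_closed[OF H] unfolding set_mult_def by blast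
  qed
  show "H \<subseteq> N <#> H"
  proof
    fix x assume x: "x \<in> H"
    then have "x = \<one> \<otimes> x" using subgroup.mem_carrier[OF H] by simp
    then show "x \<in> N <#> H" using x subgroup.one_closed[OF N] unfolding set_mult_def by blast
  qed
qed

lemma set_mult_least:
  assumes "subgroup L G" "N \<subseteq> L" "H \<subseteq> L"
  shows "N <#> H \<subseteq> L"
  using assms subgroup.m_closed[OF assms(1)] by (auto simp: set_mult_def)

lemma normal_conj_closed:
  "N \<lhd> G \<Longrightarrow> g \<in> carrier G \<Longrightarrow> x \<in> N \<Longrightarrow> g \<otimes> x \<otimes> inv g \<in> N"
  by (simp add: normal_inv_iff)

lemma normal_set_mult_subgroup:
  assumes "N \<lhd> G" "subgroup H G"
  shows "subgroup (N <#> H) G"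
  using assms normal_conj_closed[OF assms(1)] subgroup.mem_carrier[OF assms(2)] normal_imp_subgroup
  by (intro set_mult_subgroup) blast+

end

context finite_group
begin

text \<open>The quotient \<open>K/N\<close> has no proper nontrivial subgroup, hence prime order.
  The argument stays inside \<open>K\<close>: an element \<open>z\<close> of order \<open>p\<close>
  modulo \<open>N\<close> satisfies \<open>K = N <#> ?L\<close> by maximality, and the product
  formula gives the index.\<close>

lemma prime_index:
  assumes N: "subgroup N G" and K: "subgroup K G" and NK: "N \<subset> K"
    and conj: "\<And>h x. h \<in> K \<Longrightarrow> x \<in> N \<Longrightarrow> h \<otimes> x \<otimes> inv h \<in> N"
    and max: "\<And>L. subgroup L G \<Longrightarrow> N \<subseteq> L \<Longrightarrow> L \<subseteq> K \<Longrightarrow> L = N \<or> L = K"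
  obtains p where "Factorial_Ring.prime p" "card K = card N * p"
proof -
  obtain y where y: "y \<in> K" "y \<notin> N" using NK by blast
  have yc: "y \<in> carrier G" using y subgroup.mem_carrier[OF K] by blast
  \<comment> \<open>\<open>k\<close> is the order of \<open>y\<close> modulo \<open>N\<close>;
    replacing \<open>y\<close> by its power with exponent \<open>k/p\<close>, for a prime
    \<open>p\<close> dividing \<open>k\<close>, makes this order prime.\<close>
  define k where "k = (LEAST k::nat. k > 0 \<and> y [^] k \<in> N)"
  have ex: "\<exists>k::nat. k > 0 \<and> y [^] k \<in> N"
    using ord_pos[OF yc] subgroup.one_closed[OF N] pow_ord_eq_1[OF yc] by metis
  have k: "k > 0" "y [^] k \<in> N" using LeastI_ex[OF ex] by (auto simp: k_def)
  have min: "y [^] j \<notin> N" if "0 < j" "j < k" for j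
    using not_less_Least[of j "\<lambda>k::nat. k > 0 \<and> y [^] k \<in> N"] that by (auto simp: k_def)
  have "k \<noteq> 1" using k y yc by auto
  then obtain p where p: "Factorial_Ring.prime p" "p dvd k" using prime_factor_nat by blast
  then obtain j where j: "k = p * j" by blast
  define z where "z = y [^] j"
  have "p > 1" using p prime_gt_1_nat by blast
  then have "0 < j" "j < k" using k j by auto
  then have zN: "z \<notin> N" using min by (simp add: z_def)
  have zp: "z [^] p \<in> N" using k yc by (simp add: z_def nat_pow_pow j mult.commute)
  have zK: "z \<in> K" using y K by (simp add: z_def subgroup_nat_pow_closed)
  have zc: "z \<in> carrier G" using yc by (simp add: z_def)
  have iff: "z [^] i \<in> N \<longleftrightarrow> p dvd i" for i :: nat
  proof
    assume "z [^] i \<in> N"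
    then have "\<not> coprime i p" using pow_coprime_mem[OF N zc _ zp] zN by blast
    then show "p dvd i" using p(1) by (metis coprime_commute prime_imp_coprime_nat)
  next
    assume "p dvd i"
    then obtain m where "i = p * m" by blast
    then show "z [^] i \<in> N"
      using subgroup_nat_pow_closed[OF N zp, of m] zc by (simp add: nat_pow_pow)
  qed
  let ?L = "generate G {z}"
  have L: "subgroup ?L G" by (rule generate_singleton_subgroup[OF zc])
  have LK: "?L \<subseteq> K" by (rule generate_singleton_subset[OF K zK])
  have "subgroup (N <#> ?L) G"
    using LK conj by (intro set_mult_subgroup N L) blast
  then have NL: "N <#> ?L = K"
    using max[of "N <#> ?L"] set_mult_upper[OF N L] set_mult_least[OF K _ LK, of N] NK zN
      generate_singleton_self[of z] by blast
  have pd: "p dvd ord z"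
    using iff[of "ord z"] subgroup.one_closed[OF N] zc by simp
  have "N \<inter> ?L = generate G {z [^] p}"
    using generate_singleton[OF zc] generate_singleton[of "z [^] p"] zc iff
    by (auto simp: nat_pow_pow elim!: dvdE)
  then have "card (N \<inter> ?L) = ord z div p"
    using card_generate[of "z [^] p"] ord_pow[OF zc pd] zc \<open>p > 1\<close> by simp
  then have "card K * (ord z div p) = card N * (ord z div p * p)"
    using card_set_mult[OF N L] NL card_generate[OF zc] pd by simp
  then have "card K = card N * p"
    using pd ord_pos[OF zc] by (auto elim!: dvdE)
  with p that show ?thesis by blast
qed

text \<open>The double cosets \<open>H g K\<close> that are not single left cosets of \<open>K\<close> have size divisible by
  \<open>p |K|\<close>. This stands in for the action of \<open>H\<close> on the cosets of \<open>K\<close>.\<close>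

lemma set_mult_conj_fixed:
  assumes p: "Factorial_Ring.prime p" and H: "subgroup H G" "card H = p ^ k" and K: "subgroup K G"
  shows "p * card K dvd card (carrier G - {g \<in> carrier G. \<forall>h\<in>H. inv g \<otimes> h \<otimes> g \<in> K})"
    (is "_ dvd card (_ - ?T)")
proof -
  note Hc = subgroup.mem_carrier[OF H(1)] and Kc = subgroup.mem_carrier[OF K]
  define C where "C g = {h \<otimes> g \<otimes> x |h x. h \<in> H \<and> x \<in> K}" for g
  let ?E = "carrier G - ?T"
  have C_self: "g \<in> C g" if "g \<in> carrier G" for g
  proof -
    have "g = \<one> \<otimes> g \<otimes> \<one>" using that by simp
    then show ?thesis
      using subgroup.one_closed[OF H(1)] subgroup.one_closed[OF K] unfolding C_def by blast
  qed
  have C_carrier: "C g \<subseteq> carrier G" if "g \<in> carrier G" for g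
    using that Hc Kc by (auto simp: C_def)
  have C_sub: "C u \<subseteq> C g" if "u \<in> C g" "g \<in> carrier G" for u g
  proof
    obtain h x where u: "u = h \<otimes> g \<otimes> x" "h \<in> H" "x \<in> K" using \<open>u \<in> C g\<close> by (auto simp: C_def)
    fix v assume "v \<in> C u"
    then obtain h' x' where v: "v = h' \<otimes> u \<otimes> x'" "h' \<in> H" "x' \<in> K" by (auto simp: C_def)
    have "v = (h' \<otimes> h) \<otimes> g \<otimes> (x \<otimes> x')"
      using u v Hc Kc that by (simp add: m_assoc)
    moreover have "h' \<otimes> h \<in> H" "x \<otimes> x' \<in> K"
      using u v H K by (auto intro: subgroup.m_closed)
    ultimately show "v \<in> C g" unfolding C_def by blast
  qed
  have C_sym: "g \<in> C u" if "u \<in> C g" "g \<in> carrier G" for u g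
  proof -
    obtain h x where u: "u = h \<otimes> g \<otimes> x" "h \<in> H" "x \<in> K" using \<open>u \<in> C g\<close> by (auto simp: C_def)
    have "inv h \<otimes> u \<otimes> inv x = (inv h \<otimes> h) \<otimes> g \<otimes> (x \<otimes> inv x)"
      using u Hc Kc that by (simp only: m_assoc m_closed inv_closed)
    then have "g = inv h \<otimes> u \<otimes> inv x" using u Hc Kc that by simp
    moreover have "inv h \<in> H" "inv x \<in> K"
      using u H K by (auto intro: subgroup.m_inv_closed)
    ultimately show ?thesis unfolding C_def by blast
  qed
  have T_C: "u \<in> ?T" if "g \<in> ?T" "u \<in> C g" for g u
  proof -
    have g: "g \<in> carrier G" using that by blast
    obtain h x where u: "u = h \<otimes> g \<otimes> x" "h \<in> H" "x \<in> K" using \<open>u \<in> C g\<close> by (auto simp: C_def)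
    have "inv u \<otimes> l \<otimes> u \<in> K" if l: "l \<in> H" for l
    proof -
      have "inv g \<otimes> (inv h \<otimes> l \<otimes> h) \<otimes> g \<in> K"
        using \<open>g \<in> ?T\<close> l u H by (auto intro: subgroup.m_closed subgroup.m_inv_closed)
      then have "inv x \<otimes> (inv g \<otimes> (inv h \<otimes> l \<otimes> h) \<otimes> g) \<otimes> x \<in> K"
        using u K by (auto intro: subgroup.m_closed subgroup.m_inv_closed)
      also have "inv x \<otimes> (inv g \<otimes> (inv h \<otimes> l \<otimes> h) \<otimes> g) \<otimes> x = inv u \<otimes> l \<otimes> u"
        using u l g Hc Kc by (simp add: m_assoc inv_mult_group)
      finally show ?thesis .
    qed
    then show ?thesis using C_carrier[OF g] \<open>u \<in> C g\<close> by blast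
  qed
  have E: "\<Union>(C ` ?E) = ?E"
  proof
    show "?E \<subseteq> \<Union>(C ` ?E)" using C_self by blast
    show "\<Union>(C ` ?E) \<subseteq> ?E"
      using T_C C_sym C_carrier by blast
  qed
  have card_C: "p * card K dvd card (C g)" if g: "g \<in> ?E" for g
  proof -
    have gc: "g \<in> carrier G" using g by blast
    define K' where "K' = (\<lambda>x. g \<otimes> x \<otimes> inv g) ` K"
    have K': "subgroup K' G" "card K' = card K"
      using conj_subgroup[OF K gc] by (auto simp: K'_def)
    \<comment> \<open>The double coset \<open>HgK\<close> is a right translate of the product of
      \<open>H\<close> and \<open>gKg^-1\<close>, so the product formula gives its size.\<close>
    have "C g = (\<lambda>x. x \<otimes> g) ` (H <#> K')"
    proof (intro equalityI subsetI)
      fix u assume "u \<in> C g"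
      then obtain h x where u: "u = h \<otimes> g \<otimes> x" "h \<in> H" "x \<in> K" by (auto simp: C_def)
      have "u = (h \<otimes> (g \<otimes> x \<otimes> inv g)) \<otimes> g"
        using u gc Hc Kc by (simp add: m_assoc)
      then show "u \<in> (\<lambda>x. x \<otimes> g) ` (H <#> K')"
        using u by (auto simp: K'_def set_mult_def)
    next
      fix u assume "u \<in> (\<lambda>x. x \<otimes> g) ` (H <#> K')"
      then obtain h x where u: "u = (h \<otimes> (g \<otimes> x \<otimes> inv g)) \<otimes> g" "h \<in> H" "x \<in> K"
        by (auto simp: K'_def set_mult_def)
      have "u = h \<otimes> g \<otimes> x" using u gc Hc Kc by (simp add: m_assoc)
      then show "u \<in> C g" using u by (auto simp: C_def)
    qed
    moreover have "H <#> K' \<subseteq> carrier G"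
      using H K' by (intro setmult_subset_G subgroup.subset)
    then have "inj_on (\<lambda>x. x \<otimes> g) (H <#> K')"
      using inj_on_subset[OF inj_on_multc[OF gc]] by blast
    ultimately have card: "card (C g) = card (H <#> K')"
      by (simp add: card_image)
    have "card (H \<inter> K') dvd p ^ k"
      using card_subgroup_dvd[OF subgroups_Inter_pair[OF H(1) K'(1)] H(1)] H(2) by simp
    then obtain j where j: "j \<le> k" "card (H \<inter> K') = p ^ j"
      using p divides_primepow_nat by blast
    \<comment> \<open>Equality would put \<open>H\<close> inside \<open>gKg^-1\<close> and thus
      \<open>g\<close> into the excluded set. So at least one factor \<open>p\<close> remains in the
      index of \<open>H \<inter> K'\<close> in \<open>H\<close>.\<close>
    have "j \<noteq> k"
    proof
      assume "j = k"
      then have "H \<inter> K' = H"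
        using j H subgroup_eqI[OF H(1), of "H \<inter> K'"] by simp
      have "inv g \<otimes> h \<otimes> g \<in> K" if "h \<in> H" for h
      proof -
        have "h \<in> K'" using that \<open>H \<inter> K' = H\<close> by blast
        then obtain x where "x \<in> K" "h = g \<otimes> x \<otimes> inv g" by (auto simp: K'_def)
        moreover from this have "inv g \<otimes> h \<otimes> g = (inv g \<otimes> g) \<otimes> x \<otimes> (inv g \<otimes> g)"
          using gc Kc by (simp only: m_assoc m_closed inv_closed)
        ultimately show ?thesis using gc Kc by simp
      qed
      then show False using g by blast
    qed
    then have k: "k = j + Suc (k - j - 1)" using j by simp
    have "card (H <#> K') * p ^ j = p ^ k * card K"
      using card_set_mult[OF H(1) K'(1)] j H K' by simp
    also have "\<dots> = p ^ Suc (k - j - 1) * card K * p ^ j"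
      by (subst k) (simp add: power_add mult_ac)
    finally have "card (H <#> K') = p ^ Suc (k - j - 1) * card K"
      using p by (simp add: prime_gt_0_nat)
    then show ?thesis unfolding card by simp
  qed
  have "p * card K dvd card (\<Union>(C ` ?E))"
  proof (rule dvd_partition)
    show "finite (\<Union>(C ` ?E))" unfolding E by simp
    show "\<forall>c\<in>C ` ?E. p * card K dvd card c" using card_C by blast
    show "\<forall>c1\<in>C ` ?E. \<forall>c2\<in>C ` ?E. c1 \<noteq> c2 \<longrightarrow> c1 \<inter> c2 = {}"
    proof (intro ballI impI, rule ccontr)
      fix c1 c2 assume c: "c1 \<in> C ` ?E" "c2 \<in> C ` ?E" "c1 \<noteq> c2" "c1 \<inter> c2 \<noteq> {}"
      then obtain g1 g2 u where *: "g1 \<in> carrier G" "g2 \<in> carrier G" "c1 = C g1" "c2 = C g2"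
        "u \<in> C g1" "u \<in> C g2" by blast
      then have "u \<in> carrier G" using C_carrier by blast
      then have "C g1 = C u" "C g2 = C u" using * C_sub C_sym by blast+
      then show False using * c by blast
    qed
  qed
  then show ?thesis unfolding E .
qed

end

section \<open>Sylow subgroups and their normalizers\<close>

context group
begin

text \<open>Raising \<open>(xy)^n = \<one>\<close> to the power \<open>ord y\<close> removes
  \<open>y\<close>; so \<open>ord x\<close> divides \<open>n * ord y\<close>, hence
  \<open>n\<close>, and symmetrically for \<open>ord y\<close>.\<close>

lemma ord_mult_coprime:
  assumes x: "x \<in> carrier G" and y: "y \<in> carrier G" and xy: "x \<otimes> y = y \<otimes> x"
    and c: "coprime (ord x) (ord y)"
  shows "ord (x \<otimes> y) = ord x * ord y"
proof -
  have "(x \<otimes> y) [^] n = \<one> \<longleftrightarrow> ord x * ord y dvd n" for n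
  proof
    assume n: "(x \<otimes> y) [^] n = \<one>"
    have eq: "x [^] (n * k) \<otimes> y [^] (n * k) = \<one>" for k
      using n x y xy by (metis m_closed nat_pow_one nat_pow_pow pow_mult_distrib)
    have "y [^] (n * ord y) = \<one>" "x [^] (n * ord x) = \<one>"
      using x y by (simp_all add: pow_eq_id)
    then have "x [^] (n * ord y) = \<one>" "y [^] (n * ord x) = \<one>"
      using eq[of "ord y"] eq[of "ord x"] x y by simp_all
    then have "ord x dvd n * ord y" "ord y dvd n * ord x"
      using x y by (simp_all add: pow_eq_id)
    then have "ord x dvd n" "ord y dvd n"
      using c by (simp_all add: coprime_dvd_mult_left_iff coprime_commute)
    then show "ord x * ord y dvd n" using c by (simp add: divides_mult)
  next
    assume "ord x * ord y dvd n"
    then have "x [^] n = \<one>" "y [^] n = \<one>"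
      using x y by (auto simp: pow_eq_id elim!: dvdE)
    then show "(x \<otimes> y) [^] n = \<one>"
      using x y xy by (simp add: pow_mult_distrib)
  qed
  then show ?thesis using x y by (simp add: ord_unique)
qed

lemma normal_set_mult:
  assumes N: "N \<lhd> G" and M: "M \<lhd> G"
  shows "N <#> M \<lhd> G"
  unfolding normal_inv_iff
proof (intro conjI ballI)
  show "subgroup (N <#> M) G"
    using N M by (intro normal_set_mult_subgroup normal_imp_subgroup)
  fix g u assume g: "g \<in> carrier G" and "u \<in> N <#> M"
  then obtain x y where u: "u = x \<otimes> y" "x \<in> N" "y \<in> M" by (auto simp: set_mult_def)
  have c: "x \<in> carrier G" "y \<in> carrier G"
    using u subgroup.mem_carrier[OF normal_imp_subgroup[OF N]]
      subgroup.mem_carrier[OF normal_imp_subgroup[OF M]] by simp_all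
  have "(g \<otimes> x \<otimes> inv g) \<otimes> (g \<otimes> y \<otimes> inv g) = g \<otimes> x \<otimes> (inv g \<otimes> g) \<otimes> y \<otimes> inv g"
    using c g by (simp only: m_assoc m_closed inv_closed)
  then have "g \<otimes> u \<otimes> inv g = (g \<otimes> x \<otimes> inv g) \<otimes> (g \<otimes> y \<otimes> inv g)"
    using c g u by (simp add: m_assoc)
  then show "g \<otimes> u \<otimes> inv g \<in> N <#> M"
    using u normal_conj_closed[OF N g] normal_conj_closed[OF M g] by (auto simp: set_mult_def)
qed

end

context finite_group
begin

lemma normal_coprime_mem_rel:
  assumes L: "subgroup L G" and N: "subgroup N G" "N \<subseteq> L"
    and conj: "\<And>g x. g \<in> L \<Longrightarrow> x \<in> N \<Longrightarrow> g \<otimes> x \<otimes> inv g \<in> N"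
    and x: "x \<in> L" "x [^] (j::nat) = \<one>"
    and k: "card L = card N * k" "coprime j k"
  shows "x \<in> N"
proof -
  interpret L: group "G\<lparr>carrier := L\<rparr>" using L by (rule subgroup_imp_group)
  interpret L: finite_group "G\<lparr>carrier := L\<rparr>"
    by unfold_locales (simp add: L)
  have "N \<lhd> G\<lparr>carrier := L\<rparr>"
    using conj N L by (simp add: L.normal_inv_iff subgroup_incl m_inv_consistent)
  then show ?thesis
    using L.normal_coprime_mem[of N x j k] x k by (simp add: nat_pow_consistent[symmetric])
qed

text \<open>For a prime that does not divide the group order the multiplicity is 0 and the trivial
  subgroup qualifies, so that every prime has a Sylow subgroup.\<close>

definition sylow_subgroup :: "nat \<Rightarrow> 'a set \<Rightarrow> bool" where
  "sylow_subgroup p P \<longleftrightarrow> subgroup P G \<and> card P = p ^ multiplicity p (card (carrier G))"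

lemma sylow_subgroup_imp_subgroup: "sylow_subgroup p P \<Longrightarrow> subgroup P G"
  by (simp add: sylow_subgroup_def)

lemma card_carrier_pos: "card (carrier G) > 0"
  by (rule card_subgroup_pos[OF subgroup_self])

lemma exists_sylow_subgroup:
  assumes "Factorial_Ring.prime p"
  obtains P where "sylow_subgroup p P"
  using exists_prime_power_subgroup[OF subgroup_self assms, of "multiplicity p (card (carrier G))"]
  by (auto simp: sylow_subgroup_def multiplicity_dvd)

lemma sylow_index:
  assumes p: "Factorial_Ring.prime p" and P: "sylow_subgroup p P"
    and L: "subgroup L G" "P \<subseteq> L"
  obtains k where "card L = card P * k" "\<not> p dvd k"
proof -
  obtain k where k: "card L = card P * k"
    using card_subgroup_dvd[OF sylow_subgroup_imp_subgroup[OF P] L] by blast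
  have "\<not> p dvd k"
  proof
    assume "p dvd k"
    then have "p ^ Suc (multiplicity p (card (carrier G))) dvd card L"
      using P k by (auto simp: sylow_subgroup_def)
    also have "card L dvd card (carrier G)"
      using L by (intro card_subgroup_dvd subgroup_self subgroup.subset)
    finally have "Suc (multiplicity p (card (carrier G))) \<le> multiplicity p (card (carrier G))"
      using p card_carrier_pos by (intro multiplicity_geI) auto
    then show False by simp
  qed
  with k that show ?thesis by blast
qed

lemma sylow_normal_mem:
  assumes p: "Factorial_Ring.prime p" and P: "sylow_subgroup p P"
    and L: "subgroup L G" "P \<subseteq> L"
    and conj: "\<And>g x. g \<in> L \<Longrightarrow> x \<in> P \<Longrightarrow> g \<otimes> x \<otimes> inv g \<in> P"
    and x: "x \<in> L" "x [^] (p ^ j :: nat) = \<one>"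
  shows "x \<in> P"
proof -
  obtain k where k: "card L = card P * k" "\<not> p dvd k"
    using sylow_index[OF p P L] .
  then have "coprime (p ^ j) k"
    using p by (simp add: prime_imp_coprime)
  then show ?thesis
    using normal_coprime_mem_rel[OF L(1) sylow_subgroup_imp_subgroup[OF P] L(2) conj x k(1)] by simp
qed

text \<open>By \<open>set_mult_conj_fixed\<close>, the elements of \<open>L\<close> that do not
  conjugate \<open>Q\<close> into \<open>P\<close> number a multiple of \<open>p * card P\<close>,
  whereas \<open>card L\<close> is no such multiple. So some element of \<open>L\<close>
  does.\<close>

lemma sylow_conj:
  assumes p: "Factorial_Ring.prime p" and P: "sylow_subgroup p P" and Q: "sylow_subgroup p Q"
    and L: "subgroup L G" "P \<subseteq> L" "Q \<subseteq> L"
  obtains g where "g \<in> L" "\<And>x. x \<in> Q \<Longrightarrow> inv g \<otimes> x \<otimes> g \<in> P"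
proof -
  interpret L: group "G\<lparr>carrier := L\<rparr>" using L by (intro subgroup_imp_group)
  interpret L: finite_group "G\<lparr>carrier := L\<rparr>"
    by unfold_locales (simp add: L)
  let ?T = "{g \<in> L. \<forall>h\<in>Q. inv g \<otimes> h \<otimes> g \<in> P}"
  have T: "?T = {g \<in> L. \<forall>h\<in>Q. inv\<^bsub>G\<lparr>carrier := L\<rparr>\<^esub> g \<otimes> h \<otimes> g \<in> P}"
    using L by (auto simp: m_inv_consistent)
  have "p * card P dvd card (L - ?T)"
    using L.set_mult_conj_fixed[OF p, of Q _ P] P Q L
    unfolding T by (simp add: sylow_subgroup_def subgroup_incl)
  moreover have "\<not> p * card P dvd card L"
  proof -
    obtain k where k: "card L = card P * k" "\<not> p dvd k"
      using sylow_index[OF p P L(1,2)] .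
    moreover have "card P > 0"
      using card_subgroup_pos[OF sylow_subgroup_imp_subgroup[OF P]] .
    ultimately show ?thesis by (simp add: mult.commute[of p])
  qed
  ultimately have "?T \<noteq> {}" by (metis Diff_empty)
  then show ?thesis using that by blast
qed

text \<open>Conjugation preserves the order, so in a finite group one inclusion between
  \<open>H\<close> and its conjugate is already equality.\<close>

lemma normalizer_iff:
  assumes H: "subgroup H G"
  shows "g \<in> normalizer G H \<longleftrightarrow> g \<in> carrier G \<and> (\<forall>x\<in>H. g \<otimes> x \<otimes> inv g \<in> H)"
proof -
  have eq: "g <# H #> inv g = (\<lambda>x. g \<otimes> x \<otimes> inv g) ` H"
    by (auto simp: l_coset_def r_coset_def)
  have "g \<in> normalizer G H \<longleftrightarrow> g \<in> carrier G \<and> (\<lambda>x. g \<otimes> x \<otimes> inv g) ` H = H"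
    using subgroup.subset[OF H] by (auto simp: normalizer_def stabilizer_def eq)
  also have "\<dots> \<longleftrightarrow> g \<in> carrier G \<and> (\<lambda>x. g \<otimes> x \<otimes> inv g) ` H \<subseteq> H"
    using card_subset_eq[OF finite_subgroup[OF H]] conj_subgroup(3)[OF H] by auto
  finally show ?thesis by auto
qed

lemma normalizer_subgroup: "subgroup H G \<Longrightarrow> subgroup (normalizer G H) G"
  by (intro normalizer_imp_subgroup subgroup.subset)

lemma normalizer_upper:
  assumes H: "subgroup H G"
  shows "H \<subseteq> normalizer G H"
  using subgroup.m_closed[OF H] subgroup.m_inv_closed[OF H] subgroup.mem_carrier[OF H]
  by (simp add: subset_iff normalizer_iff[OF H])

lemma sylow_normalizer_mem:
  assumes p: "Factorial_Ring.prime p" and P: "sylow_subgroup p P"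
    and x: "x \<in> normalizer G P" "x [^] (p ^ j :: nat) = \<one>"
  shows "x \<in> P"
  using sylow_subgroup_imp_subgroup[OF P]
  by (intro sylow_normal_mem[OF p P _ _ _ x])
    (simp_all add: normalizer_subgroup normalizer_upper normalizer_iff)

lemma sylow_subgroup_conj_pow:
  assumes P: "sylow_subgroup p P" and x: "x \<in> P" and g: "g \<in> carrier G"
  shows "(g \<otimes> x \<otimes> inv g) [^] (p ^ multiplicity p (card (carrier G)) :: nat) = \<one>"
proof -
  have P': "subgroup P G" by (rule sylow_subgroup_imp_subgroup[OF P])
  show ?thesis
    using pow_card_eq_one[OF conj_subgroup(1)[OF P' g], of "g \<otimes> x \<otimes> inv g"] x P
    by (simp add: conj_subgroup(3)[OF P' g] sylow_subgroup_def)
qed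

text \<open>When \<open>P\<close> acts on the left cosets of its normalizer, only the normalizer
  itself is fixed: if \<open>g^-1 P g\<close> lies in it, the elements of this conjugate have
  \<open>p\<close>-power order and normalize \<open>P\<close>, hence belong to \<open>P\<close>, and
  \<open>g\<close> normalizes \<open>P\<close>. The number of remaining elements,
  \<open>card ?N * (k - 1)\<close>, is therefore divisible by \<open>p * card ?N\<close>.\<close>

lemma sylow_count:
  assumes p: "Factorial_Ring.prime p" and P: "sylow_subgroup p P"
    and k: "card (carrier G) = card (normalizer G P) * k"
  shows "p dvd k - 1"
proof -
  let ?N = "normalizer G P"
  have P': "subgroup P G" by (rule sylow_subgroup_imp_subgroup[OF P])
  have N: "subgroup ?N G" by (rule normalizer_subgroup[OF P'])
  have "{g \<in> carrier G. \<forall>h\<in>P. inv g \<otimes> h \<otimes> g \<in> ?N} = ?N"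
  proof (intro equalityI subsetI)
    fix g assume "g \<in> {g \<in> carrier G. \<forall>h\<in>P. inv g \<otimes> h \<otimes> g \<in> ?N}"
    then have g: "g \<in> carrier G" "\<And>h. h \<in> P \<Longrightarrow> inv g \<otimes> h \<otimes> g \<in> ?N" by auto
    have "inv g \<otimes> h \<otimes> inv (inv g) \<in> P" if "h \<in> P" for h
      using g that by (intro sylow_normalizer_mem[OF p P _ sylow_subgroup_conj_pow[OF P]]) auto
    then have "inv g \<in> ?N"
      using g P' by (simp add: normalizer_iff)
    then show "g \<in> ?N"
      using subgroup.m_inv_closed[OF N, of "inv g"] g by simp
  next
    fix g assume g: "g \<in> ?N"
    then have "inv g \<otimes> h \<otimes> g \<in> ?N" if "h \<in> P" for h
      using that normalizer_upper[OF P'] N by (auto intro!: subgroup.m_closed subgroup.m_inv_closed)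
    then show "g \<in> {g \<in> carrier G. \<forall>h\<in>P. inv g \<otimes> h \<otimes> g \<in> ?N}"
      using g subgroup.mem_carrier[OF N] by blast
  qed
  then have "p * card ?N dvd card (carrier G - ?N)"
    using set_mult_conj_fixed[OF p P' _ N] P by (auto simp: sylow_subgroup_def)
  also have "card (carrier G - ?N) = card ?N * (k - 1)"
    using k subgroup.subset[OF N] finite_subgroup[OF N]
    by (simp add: card_Diff_subset diff_mult_distrib2)
  finally show ?thesis
    using card_subgroup_pos[OF N] by (simp add: mult.commute[of p])
qed

end

section \<open>Groups with dense solitary subgroups\<close>

locale dense_group = finite_group +
  assumes dense: "dense_solitary_subgroups G"
begin

lemma dense_between:
  assumes "subgroup H G" "subgroup L G" "subgroup K G" "H \<subset> L" "L \<subset> K"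
  obtains S where "solitary_subgroup S G" "H \<subset> S" "S \<subset> K"
proof -
  have "\<not> maximal_subgroup H (G\<lparr>carrier := K\<rparr>)"
    using assms by (subst maximal_subgroup_iff) auto
  then have "\<exists>S. solitary_subgroup S G \<and> H \<subset> S \<and> S \<subset> K"
    using dense assms unfolding dense_solitary_subgroups_def by blast
  then show ?thesis using that by blast
qed

text \<open>Density turns the absence of solitary subgroups between \<open>S\<close> and
  \<open>K\<close> into the absence of any subgroup between them; as \<open>S\<close> is normal,
  \<open>prime_index\<close> applies.\<close>

lemma solitary_prime_index:
  assumes S: "solitary_subgroup S G" and K: "subgroup K G" and SK: "S \<subset> K"
    and max: "\<And>T. solitary_subgroup T G \<Longrightarrow> S \<subset> T \<Longrightarrow> T \<subset> K \<Longrightarrow> False"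
  obtains p where "Factorial_Ring.prime p" "card K = card S * p"
proof (rule prime_index[OF solitary_subgroup_imp_subgroup[OF S] K SK _ _ that])
  show "h \<otimes> x \<otimes> inv h \<in> S" if "h \<in> K" "x \<in> S" for h x
    using that subgroup.mem_carrier[OF K] normal_conj_closed[OF solitary_imp_normal[OF S]] by blast
  show "L = S \<or> L = K" if L: "subgroup L G" "S \<subseteq> L" "L \<subseteq> K" for L
  proof (rule ccontr)
    assume "\<not> (L = S \<or> L = K)"
    with L have "S \<subset> L" "L \<subset> K" by auto
    from dense_between[OF solitary_subgroup_imp_subgroup[OF S] L(1) K this] max show False by blast
  qed
qed

text \<open>\<open>S\<close> is a solitary proper subgroup of largest order, with the trivial
  subgroup as first candidate. \<open>H\<close> itself need not be solitary.\<close>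

lemma solitary_below:
  assumes H: "subgroup H G" "H \<noteq> {\<one>}"
  obtains S p where "solitary_subgroup S G" "S \<subset> H" "Factorial_Ring.prime p" "card H = card S * p"
proof -
  let ?P = "\<lambda>S. solitary_subgroup S G \<and> S \<subset> H"
  have "?P {\<one>}" using H subgroup.one_closed[OF H(1)] solitary_one by blast
  moreover have "\<forall>S. ?P S \<longrightarrow> card S < Suc (card H)"
    using finite_subgroup[OF H(1)] card_mono by (auto simp: less_Suc_eq_le)
  ultimately obtain S where S: "?P S" and max: "\<And>T. ?P T \<Longrightarrow> card T \<le> card S"
    using ex_has_greatest_nat[of ?P "{\<one>}" card "Suc (card H)"] by blast
  have False if T: "solitary_subgroup T G" "S \<subset> T" "T \<subset> H" for T
    using max[of T] T psubset_card_mono[OF _ T(2)] finite_subgroup[OF solitary_subgroup_imp_subgroup[OF T(1)]]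
    by simp
  with solitary_prime_index[of S H] S H that show ?thesis by blast
qed

text \<open>\<open>T\<close> is a solitary proper overgroup of least order, with the whole group as
  first candidate. The prime index then excludes every intermediate subgroup, solitary or
  not.\<close>

lemma solitary_above:
  assumes S: "solitary_subgroup S G" "S \<noteq> carrier G"
  obtains T p where "solitary_subgroup T G" "S \<subset> T" "Factorial_Ring.prime p" "card T = card S * p"
    "\<And>L. subgroup L G \<Longrightarrow> S \<subseteq> L \<Longrightarrow> L \<subseteq> T \<Longrightarrow> L = S \<or> L = T"
proof -
  let ?P = "\<lambda>T. solitary_subgroup T G \<and> S \<subset> T"
  have "?P (carrier G)"
    using S subgroup.subset[OF solitary_subgroup_imp_subgroup[OF S(1)]] solitary_carrier[OF fin] by blast
  then obtain T where T: "?P T" and min: "\<And>Y. ?P Y \<Longrightarrow> card T \<le> card Y"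
    using ex_has_least_nat[of ?P "carrier G" card] by blast
  have T': "subgroup T G" using T solitary_subgroup_imp_subgroup by blast
  have none: False if Y: "solitary_subgroup Y G" "S \<subset> Y" "Y \<subset> T" for Y
    using min[of Y] Y psubset_card_mono[OF finite_subgroup[OF T'] Y(3)] by simp
  obtain p where p: "Factorial_Ring.prime p" "card T = card S * p"
    using solitary_prime_index[OF S(1) T'] T none by blast
  have "L = S \<or> L = T" if L: "subgroup L G" "S \<subseteq> L" "L \<subseteq> T" for L
  proof -
    obtain k where k: "card L = card S * k"
      using card_subgroup_dvd[OF solitary_subgroup_imp_subgroup[OF S(1)] L(1,2)] by blast
    have "card L dvd card T" by (rule card_subgroup_dvd[OF L(1) T' L(3)])
    then have "k dvd p"
      using k p card_subgroup_pos[OF solitary_subgroup_imp_subgroup[OF S(1)]] by simp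
    then have "k = 1 \<or> k = p" using p(1) by (simp add: prime_nat_iff)
    then show ?thesis
      using k p L subgroup_eqI[OF L(1), of S] subgroup_eqI[OF T', of L] by auto
  qed
  with T p that show ?thesis by blast
qed

text \<open>Iterates \<open>solitary_below\<close>; inside a \<open>p\<close>-group each step
  removes exactly one factor \<open>p\<close>. As \<open>S\<close> itself need not be solitary, the
  order \<open>p ^ k\<close> is left out.\<close>

lemma solitary_chain:
  assumes p: "Factorial_Ring.prime p" and S: "subgroup S G" "card S = p ^ k" and j: "j < k"
  obtains T where "solitary_subgroup T G" "T \<subseteq> S" "card T = p ^ j"
proof -
  have "\<exists>T. solitary_subgroup T G \<and> T \<subseteq> S \<and> card T = p ^ j"
    using S j
  proof (induction k arbitrary: S)
    case 0
    then show ?case by (blast elim: less_zeroE)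
  next
    case (Suc k)
    have "S \<noteq> {\<one>}" using Suc.prems p by (auto dest!: prime_gt_1_nat)
    then obtain T q where T: "solitary_subgroup T G" "T \<subset> S" "Factorial_Ring.prime q" "card S = card T * q"
      using solitary_below[OF Suc.prems(1)] by blast
    then have "q dvd p ^ Suc k" using Suc.prems by simp
    then have "q = p" using p T(3) prime_dvd_power primes_dvd_imp_eq by blast
    then have cX: "card T = p ^ k" using T Suc.prems p by (simp add: prime_gt_0_nat)
    show ?case
    proof (cases "j = k")
      case True
      then show ?thesis using T cX by blast
    next
      case False
      then have "j < k" using Suc.prems(3) by simp
      from Suc.IH[OF solitary_subgroup_imp_subgroup[OF T(1)] cX this] T(2) show ?thesis by blast
    qed
  qed
  then show ?thesis using that by blast
qed

text \<open>Let \<open>S\<close> be solitary of index \<open>p\<close> in \<open>H\<close>, and let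
  \<open>y\<close> lie in \<open>H\<close> but not in \<open>S\<close>. If the order
  \<open>p ^ j\<close> of \<open>y\<close> were less than that of \<open>H\<close>, there would be a
  solitary \<open>T\<close> inside \<open>S\<close> of this order, cyclic by induction; it contains
  all elements of order \<open>p ^ j\<close>, so also \<open>y\<close>. Hence \<open>y\<close>
  generates \<open>H\<close>.\<close>

lemma p_subgroup_cyclic:
  assumes p: "Factorial_Ring.prime p" and H: "subgroup H G" "card H = p ^ k"
  obtains x where "x \<in> carrier G" "H = generate G {x}"
proof -
  have "\<exists>x\<in>carrier G. H = generate G {x}"
    using H
  proof (induction k arbitrary: H rule: less_induct)
    case (less k)
    show ?case
    proof (cases k)
      case 0
      then have "H = {\<one>}"
        using less.prems subgroup.one_closed by (metis card_1_singletonE power_0 singletonD)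
      then show ?thesis using generate_one by auto
    next
      case (Suc i)
      obtain S where S: "solitary_subgroup S G" "S \<subseteq> H" "card S = p ^ i"
        using solitary_chain[OF p less.prems, of i] Suc by blast
      have S': "subgroup S G" by (rule solitary_subgroup_imp_subgroup[OF S(1)])
      have "p ^ i < p ^ k" using Suc prime_gt_1_nat[OF p] by (intro power_strict_increasing) simp_all
      then have "S \<noteq> H" using S(3) less.prems(2) by auto
      then obtain y where y: "y \<in> H" "y \<notin> S" using S(2) by blast
      have yc: "y \<in> carrier G" using y subgroup.mem_carrier[OF less.prems(1)] by blast
      have "ord y dvd p ^ k"
        using ord_dvd_card[OF less.prems(1) y(1)] less.prems(2) by simp
      then obtain j where j: "j \<le> k" "ord y = p ^ j"
        using p divides_primepow_nat by blast
      show ?thesis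
      proof (cases "j = k")
        case True
        have "generate G {y} = H"
          using generate_singleton_subset[OF less.prems(1) y(1)] less.prems j True card_generate[OF yc]
          by (intro subgroup_eqI) auto
        then show ?thesis using yc by blast
      next
        case False
        then have "j \<le> i" using j Suc by simp
        \<comment> \<open>The chain yields only orders below that of \<open>S\<close>, so for
          \<open>j = i\<close> the subgroup \<open>S\<close> itself is taken.\<close>
        obtain T where T: "solitary_subgroup T G" "T \<subseteq> S" "card T = p ^ j"
        proof (cases "j = i")
          case True
          then show ?thesis using S that by blast
        next
          case False
          then show ?thesis using \<open>j \<le> i\<close> solitary_chain[OF p S' S(3), of j] that by auto
        qed
        then obtain x where x: "x \<in> carrier G" "T = generate G {x}"
          using less.IH[of j T] False j T(3) solitary_subgroup_imp_subgroup[OF T(1)] by auto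
        then have "ord y = ord x" using T j card_generate by simp
        then have "y \<in> T" using solitary_cyclic_mem[of x y] T x yc by simp
        then show ?thesis using T y by blast
      qed
    qed
  qed
  then show ?thesis using that by blast
qed

text \<open>A generator is assembled prime by prime: normal subgroups of coprime orders commute
  elementwise, so multiplying by a generator of the next Sylow subgroup multiplies the
  orders.\<close>

lemma all_sylow_normal_imp_cyclic:
  assumes "\<And>p P. Factorial_Ring.prime p \<Longrightarrow> sylow_subgroup p P \<Longrightarrow> P \<lhd> G"
  shows "cyclic_group G"
proof -
  let ?n = "card (carrier G)"
  \<comment> \<open>Normality of the subgroup generated so far belongs to the induction claim,
    because the commutation with the next Sylow subgroup rests on it.\<close>
  have *: "\<exists>x\<in>carrier G. ord x = (\<Prod>p\<in>A. p ^ multiplicity p ?n) \<and> generate G {x} \<lhd> G"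
    if "finite A" "\<forall>p\<in>A. Factorial_Ring.prime p" for A
    using that
  proof (induction A rule: finite_induct)
    case empty
    show ?case using generate_one one_is_normal by (intro bexI[of _ \<one>]) auto
  next
    case (insert p A)
    then obtain x where x: "x \<in> carrier G" "ord x = (\<Prod>p\<in>A. p ^ multiplicity p ?n)"
      and xn: "generate G {x} \<lhd> G" by auto
    have p: "Factorial_Ring.prime p" using insert by blast
    obtain P where P: "sylow_subgroup p P" using exists_sylow_subgroup[OF p] .
    then have Pn: "P \<lhd> G" using assms p by blast
    obtain y where y: "y \<in> carrier G" "P = generate G {y}"
      using p_subgroup_cyclic[OF p] P unfolding sylow_subgroup_def by blast
    then have oy: "ord y = p ^ multiplicity p ?n"
      using P card_generate by (simp add: sylow_subgroup_def)
    have cop: "coprime (ord x) (ord y)"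
      unfolding x oy
    proof (rule prod_coprime_left)
      fix q assume "q \<in> A"
      then have "coprime q p" using insert p by (intro primes_coprime) auto
      then show "coprime (q ^ multiplicity q ?n) (p ^ multiplicity p ?n)" by simp
    qed
    have int: "generate G {x} \<inter> P = {\<one>}"
      using cop y x by (intro Int_coprime) (simp_all add: generate_singleton_subgroup card_generate)
    have comm: "x \<otimes> y = y \<otimes> x"
      using normal_imp_commuting[OF xn Pn] int generate_singleton_self y by blast
    have o: "ord (x \<otimes> y) = ord x * ord y"
      by (rule ord_mult_coprime[OF x(1) y(1) comm cop])
    have prod: "subgroup (generate G {x} <#> P) G"
      by (rule normal_imp_subgroup[OF normal_set_mult[OF xn Pn]])
    have "x \<otimes> y \<in> generate G {x} <#> P"
      using generate_singleton_self y by (auto simp: set_mult_def)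
    moreover have "card (generate G {x} <#> P) = ord x * ord y"
      using card_set_mult[of "generate G {x}" P] int x y
      by (simp add: generate_singleton_subgroup card_generate)
    ultimately have "generate G {x \<otimes> y} = generate G {x} <#> P"
      using o x y by (intro subgroup_eqI[OF prod] generate_singleton_subset[OF prod])
        (simp_all add: card_generate)
    then have "generate G {x \<otimes> y} \<lhd> G"
      using normal_set_mult[OF xn Pn] by simp
    moreover have "ord (x \<otimes> y) = (\<Prod>p\<in>insert p A. p ^ multiplicity p ?n)"
      using insert x oy o by (simp add: mult.commute)
    ultimately show ?case using x y by blast
  qed
  have "(\<Prod>p\<in>prime_factors ?n. p ^ multiplicity p ?n) = ?n"
    by (rule prime_factorization_nat[OF card_carrier_pos, symmetric])
  then obtain x where x: "x \<in> carrier G" "ord x = ?n"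
    using *[of "prime_factors ?n"] by auto
  then have "generate G {x} = carrier G"
    using generate_singleton_subset[OF subgroup_self x(1)] card_generate[OF x(1)]
    by (intro subgroup_eqI[OF subgroup_self]) auto
  then show ?thesis
    unfolding cyclic_group using x generate_pow[OF x(1)] by (intro bexI[of _ x]) (auto simp: full_SetCompr_eq)
qed

lemma nonnormal_sylow:
  assumes p: "Factorial_Ring.prime p" and P: "sylow_subgroup p P" and nP: "\<not> P \<lhd> G"
  obtains q s where "Factorial_Ring.prime q" "card (carrier G) = card (normalizer G P) * q" "p dvd q - 1"
    "s = 1 \<or> Factorial_Ring.prime s \<and> s \<noteq> p" "card (normalizer G P) = card P * s"
    "\<And>H. subgroup H G \<Longrightarrow> P \<subseteq> H \<Longrightarrow> H \<subseteq> normalizer G P \<Longrightarrow> \<not> H \<lhd> G"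
proof -
  let ?N = "normalizer G P"
  have P': "subgroup P G" by (rule sylow_subgroup_imp_subgroup[OF P])
  have N: "subgroup ?N G" by (rule normalizer_subgroup[OF P'])
  have PN: "P \<subseteq> ?N" by (rule normalizer_upper[OF P'])
  \<comment> \<open>Frattini argument: \<open>gPg^-1\<close> is a Sylow subgroup inside the normal
    subgroup \<open>L\<close>, so some \<open>l\<close> in \<open>L\<close> conjugates it back to
    \<open>P\<close>; then \<open>l^-1 g\<close> normalizes \<open>P\<close> and lies in
    \<open>L\<close>, and so does \<open>g\<close>.\<close>
  have above: "L = carrier G" if L: "subgroup L G" "?N \<subseteq> L" "L \<lhd> G" for L
  proof (intro equalityI subsetI)
    fix g assume g: "g \<in> carrier G"
    let ?Q = "(\<lambda>x. g \<otimes> x \<otimes> inv g) ` P"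
    have Q: "sylow_subgroup p ?Q"
      using conj_subgroup[OF P' g] P by (simp add: sylow_subgroup_def)
    have "?Q \<subseteq> L" using normal_conj_closed[OF L(3) g] PN L by blast
    then obtain l where l: "l \<in> L" "\<And>x. x \<in> ?Q \<Longrightarrow> inv l \<otimes> x \<otimes> l \<in> P"
      using sylow_conj[OF p P Q L(1)] PN L by blast
    have lc: "l \<in> carrier G" using l subgroup.mem_carrier[OF L(1)] by blast
    have "(inv l \<otimes> g) \<otimes> x \<otimes> inv (inv l \<otimes> g) \<in> P" if "x \<in> P" for x
    proof -
      have "inv l \<otimes> (g \<otimes> x \<otimes> inv g) \<otimes> l \<in> P" using l that by blast
      then show ?thesis
        using g lc that subgroup.mem_carrier[OF P'] by (simp add: inv_mult_group m_assoc)
    qed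
    then have "inv l \<otimes> g \<in> L"
      using g lc L by (auto simp: normalizer_iff[OF P'])
    then have "l \<otimes> (inv l \<otimes> g) \<in> L" using subgroup.m_closed[OF L(1)] l(1) by blast
    then show "g \<in> L" using g lc by (simp flip: m_assoc)
  qed (use subgroup.mem_carrier[OF L(1)] in blast)
  \<comment> \<open>All conjugates of \<open>P\<close> would lie in the normal subgroup
    \<open>H\<close>, hence in the normalizer, whose elements of \<open>p\<close>-power order all
    belong to \<open>P\<close>; so \<open>P\<close> would be normal.\<close>
  have below: "\<not> H \<lhd> G" if H: "subgroup H G" "P \<subseteq> H" "H \<subseteq> ?N" for H
  proof
    assume Hn: "H \<lhd> G"
    have "g \<otimes> x \<otimes> inv g \<in> P" if "g \<in> carrier G" "x \<in> P" for g x
      using that normal_conj_closed[OF Hn] H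
      by (intro sylow_normalizer_mem[OF p P _ sylow_subgroup_conj_pow[OF P]]) blast+
    then show False using nP P' by (simp add: normal_inv_iff)
  qed
  have "?N \<noteq> carrier G"
    using nP P' by (auto simp: normal_inv_iff set_eq_iff normalizer_iff[OF P'])
  then have NG: "?N \<subset> carrier G" using subgroup.subset[OF N] by blast
  have Nmax: "L = carrier G" if L: "subgroup L G" "?N \<subset> L" for L
  proof (rule ccontr)
    assume "L \<noteq> carrier G"
    then have "L \<subset> carrier G" using subgroup.subset[OF L(1)] by blast
    then obtain S where S: "solitary_subgroup S G" "?N \<subset> S" "S \<subset> carrier G"
      using dense_between[OF N L(1) subgroup_self L(2)] by blast
    then show False
      using above[OF solitary_subgroup_imp_subgroup[OF S(1)] _ solitary_imp_normal[OF S(1)]] by blast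
  qed
  \<comment> \<open>The index of \<open>?N\<close> is read off from two solitary subgroups:
    \<open>T\<close> is a largest one inside \<open>?N\<close>, and \<open>Y\<close> the next one
    above \<open>T\<close>. Then \<open>Y\<close> meets \<open>?N\<close> in \<open>T\<close>, and
    \<open>Y <#> ?N\<close> is the whole group since \<open>?N\<close> is maximal; so the index of
    \<open>?N\<close> equals the prime index of \<open>T\<close> in \<open>Y\<close>.\<close>
  let ?S = "\<lambda>T. solitary_subgroup T G \<and> T \<subseteq> ?N"
  have "?S {\<one>}" using subgroup.one_closed[OF N] solitary_one by blast
  moreover have "\<forall>T. ?S T \<longrightarrow> card T < Suc (card ?N)"
    using finite_subgroup[OF N] card_mono by (auto simp: less_Suc_eq_le)
  ultimately obtain T where T: "solitary_subgroup T G" "T \<subseteq> ?N"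
    and max: "\<And>Y. ?S Y \<Longrightarrow> card Y \<le> card T"
    using ex_has_greatest_nat[of ?S "{\<one>}" card "Suc (card ?N)"] by blast
  obtain Y q where Y: "solitary_subgroup Y G" "T \<subset> Y" and q: "Factorial_Ring.prime q" "card Y = card T * q"
    and TY: "\<And>L. subgroup L G \<Longrightarrow> T \<subseteq> L \<Longrightarrow> L \<subseteq> Y \<Longrightarrow> L = T \<or> L = Y"
    using solitary_above[OF T(1)] T NG by blast
  have T': "subgroup T G" and Y': "subgroup Y G"
    using T Y solitary_subgroup_imp_subgroup by blast+
  have "\<not> Y \<subseteq> ?N"
    using max[of Y] Y psubset_card_mono[OF finite_subgroup[OF Y'] Y(2)] by auto
  then have YN: "Y \<inter> ?N = T"
    using TY[OF subgroups_Inter_pair[OF Y' N]] T Y by blast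
  have "Y <#> ?N = carrier G"
    using set_mult_upper[OF Y' N] \<open>\<not> Y \<subseteq> ?N\<close>
    by (intro Nmax normal_set_mult_subgroup[OF solitary_imp_normal[OF Y(1)] N]) blast
  then have "card (carrier G) * card T = card Y * card ?N"
    using card_set_mult[OF Y' N] YN by simp
  then have q': "card (carrier G) = card ?N * q"
    using q card_subgroup_pos[OF T'] by simp
  \<comment> \<open>\<open>s\<close> is the index of \<open>P\<close> in its normalizer. By
    \<open>below\<close> no solitary subgroup lies strictly between the two, so density leaves no
    subgroup there, and a nontrivial index is prime.\<close>
  obtain s where s: "s = 1 \<or> Factorial_Ring.prime s" "card ?N = card P * s"
  proof (cases "P = ?N")
    case True
    then show ?thesis using that[of 1] by simp
  next
    case False
    then have PN': "P \<subset> ?N" using PN by blast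
    have conj: "h \<otimes> x \<otimes> inv h \<in> P" if "h \<in> ?N" "x \<in> P" for h x
      using that by (simp add: normalizer_iff[OF P'])
    have max: "L = P \<or> L = ?N" if L: "subgroup L G" "P \<subseteq> L" "L \<subseteq> ?N" for L
    proof (rule ccontr)
      assume "\<not> (L = P \<or> L = ?N)"
      then obtain S where S: "solitary_subgroup S G" "P \<subset> S" "S \<subset> ?N"
        using dense_between[OF P' L(1) N] L by blast
      then show False
        using below[OF solitary_subgroup_imp_subgroup[OF S(1)]] solitary_imp_normal[OF S(1)] by blast
    qed
    obtain s where "Factorial_Ring.prime s" "card ?N = card P * s"
      by (rule prime_index[OF P' N PN' conj max])
    then show ?thesis using that by blast
  qed
  obtain k where "card ?N = card P * k" "\<not> p dvd k"
    using sylow_index[OF p P N PN] .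
  then have "s \<noteq> p"
    using s(2) card_subgroup_pos[OF P'] by auto
  with s(1) have "s = 1 \<or> Factorial_Ring.prime s \<and> s \<noteq> p" by blast
  from that[OF q(1) q' sylow_count[OF p P q'] this s(2) below] show ?thesis .
qed

end

section \<open>The structure of noncyclic groups with dense solitary subgroups\<close>

context finite_group
begin

lemma sylow_normal_unique:
  assumes p: "Factorial_Ring.prime p" and S: "sylow_subgroup p S" "S \<lhd> G" and P: "sylow_subgroup p P"
  shows "P = S"
proof (rule subgroup_eqI[OF sylow_subgroup_imp_subgroup[OF S(1)]])
  show "P \<subseteq> S"
  proof
    fix x assume x: "x \<in> P"
    have P': "subgroup P G" and S': "subgroup S G"
      using P S sylow_subgroup_imp_subgroup by blast+
    have xc: "x \<in> carrier G" using subgroup.mem_carrier[OF P' x] .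
    have "x [^] (p ^ multiplicity p (card (carrier G))) = \<one>"
      using pow_card_eq_one[OF P' x] P by (simp add: sylow_subgroup_def)
    then show "x \<in> S"
      using sylow_normal_mem[OF p S(1) subgroup_self subgroup.subset[OF S'] _ xc]
        normal_conj_closed[OF S(2)] by blast
  qed
qed (use P S in \<open>simp add: sylow_subgroup_def\<close>)

text \<open>The commutator of \<open>x\<close> and \<open>y\<close> lies in both \<open>H\<close>
  and \<open>K\<close>. Normalization is asked of these two elements alone, since \<open>H\<close>
  will be a Sylow subgroup that is not normal in the whole group.\<close>

lemma normalizing_imp_commuting:
  assumes H: "subgroup H G" and K: "subgroup K G" and HK: "H \<inter> K = {\<one>}"
    and x: "x \<in> H" "\<And>k. k \<in> K \<Longrightarrow> x \<otimes> k \<otimes> inv x \<in> K"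
    and y: "y \<in> K" "\<And>h. h \<in> H \<Longrightarrow> y \<otimes> h \<otimes> inv y \<in> H"
  shows "x \<otimes> y = y \<otimes> x"
proof -
  have c: "x \<in> carrier G" "y \<in> carrier G"
    using x(1) y(1) subgroup.mem_carrier[OF H] subgroup.mem_carrier[OF K] by blast+
  let ?w = "x \<otimes> y \<otimes> inv x \<otimes> inv y"
  have "?w \<in> K"
    by (rule subgroup.m_closed[OF K x(2)[OF y(1)] subgroup.m_inv_closed[OF K y(1)]])
  moreover have "?w = x \<otimes> (y \<otimes> inv x \<otimes> inv y)"
    using c by (simp add: m_assoc)
  moreover have "x \<otimes> (y \<otimes> inv x \<otimes> inv y) \<in> H"
    using x(1) y(2)[OF subgroup.m_inv_closed[OF H x(1)]] by (rule subgroup.m_closed[OF H])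
  ultimately have "?w = \<one>" using HK by auto
  then have "x \<otimes> y = inv (inv x \<otimes> inv y)"
    using c by (intro inv_equality[symmetric]) (simp_all add: m_assoc)
  then show ?thesis using c by (simp add: inv_mult_group)
qed

end

context dense_group
begin

lemma noncyclic_structure:
  assumes nc: "\<not> cyclic_group G"
  obtains q d s \<alpha> a b where
    "Factorial_Ring.prime q" "Factorial_Ring.prime d" "s = 1 \<or> Factorial_Ring.prime s" "s \<noteq> d" "\<alpha> \<ge> 1"
    "coprime q (d ^ \<alpha> * s)" "card (carrier G) = q * (d ^ \<alpha> * s)"
    "a \<in> carrier G" "b \<in> carrier G" "ord a = q" "ord b = d ^ \<alpha> * s"
    "generate G {a} \<lhd> G" "a \<otimes> b \<noteq> b \<otimes> a" "a \<otimes> b [^] d = b [^] d \<otimes> a"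
proof -
  let ?n = "card (carrier G)"
  let ?bad = "\<lambda>p. Factorial_Ring.prime p \<and> (\<exists>P. sylow_subgroup p P \<and> \<not> P \<lhd> G)"
  \<comment> \<open>This bounds the primes with a non-normal Sylow subgroup, so that a largest one
    exists: for a prime outside the divisors of \<open>?n\<close> the Sylow subgroup is
    trivial.\<close>
  have dvd: "p dvd ?n" if "?bad p" for p
  proof (rule ccontr)
    assume "\<not> p dvd ?n"
    then have "multiplicity p ?n = 0" by (rule not_dvd_imp_multiplicity_0)
    moreover obtain P where P: "sylow_subgroup p P" "\<not> P \<lhd> G" using \<open>?bad p\<close> by blast
    ultimately have "card P = 1" by (simp add: sylow_subgroup_def)
    then have "P = {\<one>}"
      using subgroup.one_closed[OF sylow_subgroup_imp_subgroup[OF P(1)]] by (auto simp: card_1_singleton_iff)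
    then show False using P one_is_normal by simp
  qed
  obtain d0 where "?bad d0" using all_sylow_normal_imp_cyclic nc by blast
  moreover have "\<forall>p. ?bad p \<longrightarrow> p < Suc ?n"
    using dvd dvd_imp_le[OF _ card_carrier_pos] by (auto simp: less_Suc_eq_le)
  ultimately obtain d where bad: "?bad d" and max: "\<And>p. ?bad p \<Longrightarrow> p \<le> d"
    using ex_has_greatest_nat[of ?bad d0 id "Suc ?n"] by auto
  then obtain D where d: "Factorial_Ring.prime d" and D: "sylow_subgroup d D" "\<not> D \<lhd> G" by blast
  let ?N = "normalizer G D"
  obtain q s where q: "Factorial_Ring.prime q" "?n = card ?N * q" "d dvd q - 1"
    and s: "s = 1 \<or> Factorial_Ring.prime s \<and> s \<noteq> d" "card ?N = card D * s"
    and below: "\<And>H. subgroup H G \<Longrightarrow> D \<subseteq> H \<Longrightarrow> H \<subseteq> ?N \<Longrightarrow> \<not> H \<lhd> G"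
    using nonnormal_sylow[OF d D] by metis
  define \<alpha> where "\<alpha> = multiplicity d ?n"
  have cD: "card D = d ^ \<alpha>" using D by (simp add: sylow_subgroup_def \<alpha>_def)
  have D': "subgroup D G" by (rule sylow_subgroup_imp_subgroup[OF D(1)])
  have N: "subgroup ?N G" by (rule normalizer_subgroup[OF D'])
  have DN: "D \<subseteq> ?N" by (rule normalizer_upper[OF D'])
  have \<alpha>: "\<alpha> \<ge> 1"
    using dvd[OF bad] d card_carrier_pos unfolding \<alpha>_def by (intro multiplicity_geI) auto
  have d1: "d > 1" and q1: "q > 1" using d q prime_gt_1_nat by blast+
  have dq: "d < q" using dvd_imp_le[OF q(3)] q1 by simp
  have cN: "card ?N = d ^ \<alpha> * s" using s cD by simp
  have cG: "?n = d ^ \<alpha> * s * q" using q cN by simp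
  have s0: "s > 0" using s prime_gt_0_nat by auto
  have sd: "s \<noteq> d" using s d1 by auto
  have qd: "coprime q (d ^ \<alpha>)"
    using primes_coprime[OF q(1) d] dq by simp
  have NG: "?N \<subset> carrier G"
    using q q1 subgroup.subset[OF N] card_subgroup_pos[OF N] by (auto)
  have Qnormal: "Q \<lhd> G" if "sylow_subgroup q Q" for Q
  proof (rule ccontr)
    assume "\<not> Q \<lhd> G"
    then have "?bad q" using q(1) that by blast
    then show False using max[of q] dq by simp
  qed
  \<comment> \<open>If \<open>s = q\<close>, a solitary subgroup strictly between \<open>D\<close> and \<open>G\<close> has the order of \<open>N\<close> and, like \<open>N\<close>,
    contains the only subgroup of order \<open>q\<close> of the cyclic normal Sylow \<open>q\<close>-subgroup; so it equals \<open>N\<close>.\<close>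
  have sq: "s \<noteq> q"
  proof
    assume sq: "s = q"
    obtain Q where Q: "sylow_subgroup q Q" using exists_sylow_subgroup[OF q(1)] .
    have Q': "subgroup Q G" by (rule sylow_subgroup_imp_subgroup[OF Q])
    obtain x where x: "x \<in> carrier G" "Q = generate G {x}"
      using p_subgroup_cyclic[OF q(1) Q'] Q by (auto simp: sylow_subgroup_def)
    have in_Q: "R \<subseteq> Q" if R: "subgroup R G" "card R = q" for R
    proof
      fix y assume y: "y \<in> R"
      have "y [^] (q ^ 1) = \<one>" using pow_card_eq_one[OF R(1) y] R(2) by simp
      then show "y \<in> Q"
        using sylow_normal_mem[OF q(1) Q subgroup_self subgroup.subset[OF Q'], of y 1]
          normal_conj_closed[OF Qnormal[OF Q]] subgroup.mem_carrier[OF R(1) y] by blast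
    qed
    have "D \<subset> ?N"
      using DN cN cD sq q1 d1 by (auto)
    then obtain S where S: "solitary_subgroup S G" "D \<subset> S" "S \<subset> carrier G"
      using dense_between[OF D' N subgroup_self _ NG] by blast
    have S': "subgroup S G" by (rule solitary_subgroup_imp_subgroup[OF S(1)])
    obtain k where k: "card S = d ^ \<alpha> * k"
      using card_subgroup_dvd[OF D' S'] S cD by auto
    have "card S dvd ?n" using card_subgroup_dvd[OF S' subgroup_self] S by blast
    then have "k dvd q ^ 2"
      using k cG sq d1 by (simp add: power2_eq_square)
    then obtain i where i: "i \<le> 2" "k = q ^ i" using q(1) divides_primepow_nat by blast
    have "i \<noteq> 0"
      using subgroup_eqI[OF S', of D] S(2) k i cD by auto
    moreover have "i \<noteq> 2"
      using subgroup_eqI[OF subgroup_self, of S] S(3) k i cG sq by (auto simp: power2_eq_square)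
    ultimately have "i = 1" using i by simp
    then have cS: "card S = d ^ \<alpha> * q" using k i by simp
    obtain R where R: "subgroup R G" "R \<subseteq> S" "card R = q"
      using exists_prime_power_subgroup[OF S' q(1), of 1] cS by auto
    obtain R' where R': "subgroup R' G" "R' \<subseteq> ?N" "card R' = q"
      using exists_prime_power_subgroup[OF N q(1), of 1] cN sq by auto
    have "R = R'"
      using cyclic_subgroup_unique[OF x(1) R(1) _ R'(1)] in_Q[OF R(1,3)] in_Q[OF R'(1,3)] x R(3) R'(3)
      by simp
    have SN: "subgroup (S \<inter> ?N) G" by (rule subgroups_Inter_pair[OF S' N])
    have "d ^ \<alpha> dvd card (S \<inter> ?N)" "q dvd card (S \<inter> ?N)"
      using card_subgroup_dvd[OF D' SN] S(2) DN cD card_subgroup_dvd[OF R(1) SN] R R' \<open>R = R'\<close> by auto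
    then have "d ^ \<alpha> * q dvd card (S \<inter> ?N)"
      using qd by (simp add: divides_mult coprime_commute)
    then have "d ^ \<alpha> * q \<le> card (S \<inter> ?N)"
      using card_subgroup_pos[OF SN] by (rule dvd_imp_le)
    then have le: "card S \<le> card (S \<inter> ?N)" "card ?N \<le> card (S \<inter> ?N)"
      using cS cN sq by simp_all
    have "S \<inter> ?N = S" by (rule subgroup_eqI[OF S' _ le(1)]) simp
    moreover have "S \<inter> ?N = ?N" by (rule subgroup_eqI[OF N _ le(2)]) simp
    ultimately show False
      using below[OF S'] S(2) solitary_imp_normal[OF S(1)] by blast
  qed
  have qs: "coprime q s"
    using s(1) sq primes_coprime[OF q(1), of s] by auto
  have cop: "coprime q (d ^ \<alpha> * s)" using qd qs by simp
  have ds: "coprime (d ^ \<alpha>) s"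
    using s(1) primes_coprime[OF d, of s] by auto
  have sylow_s: "card P = s" if "Factorial_Ring.prime s" "sylow_subgroup s P" for P
  proof -
    have "coprime s (d ^ \<alpha> * q)" using ds qs by (simp add: coprime_commute)
    then have "\<not> s dvd d ^ \<alpha> * q"
      using that(1) by (metis coprime_absorb_left dvd_refl not_prime_unit)
    then have "multiplicity s (s * (d ^ \<alpha> * q)) = 1"
      using that(1) d1 q1 by (subst multiplicity_times_same) (auto simp: not_dvd_imp_multiplicity_0)
    moreover have "?n = s * (d ^ \<alpha> * q)" using cG by simp
    ultimately show ?thesis using that(2) by (simp add: sylow_subgroup_def)
  qed
  \<comment> \<open>Otherwise \<open>nonnormal_sylow\<close> applies to \<open>P\<close> as well,
    and \<open>?n = s * s' * q'\<close> with \<open>q'\<close> prime and \<open>s'\<close> equal to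
    1 or prime; comparison with the known order makes \<open>d ^ \<alpha>\<close> prime, so
    \<open>\<alpha> = 1\<close>. Density between the trivial subgroup and \<open>?N\<close>, with
    \<open>D\<close> in between, now yields a solitary subgroup of order \<open>d\<close> or
    \<open>s\<close>: a normal Sylow subgroup, against the choice of \<open>D\<close> or of
    \<open>P\<close>.\<close>
  have Pnormal: "P \<lhd> G" if sp: "Factorial_Ring.prime s" and P: "sylow_subgroup s P" for P
  proof (rule ccontr)
    assume nP: "\<not> P \<lhd> G"
    have cP: "card P = s" by (rule sylow_s[OF that])
    obtain q' s' where q': "Factorial_Ring.prime q'" "?n = card (normalizer G P) * q'"
      and s': "s' = 1 \<or> Factorial_Ring.prime s'" "card (normalizer G P) = card P * s'"
      using nonnormal_sylow[OF sp P nP] by metis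
    have eq: "s' * q' = d ^ \<alpha> * q"
      using q' s' cP cG s0 by simp
    have "Factorial_Ring.prime (d ^ \<alpha>)"
    proof -
      have "q dvd s' * q'" using eq by simp
      then consider "q dvd s'" | "q dvd q'" using q(1) prime_dvd_mult_iff by blast
      then show ?thesis
      proof cases
        case 1
        then have "s' = q" using s'(1) q(1) q1 primes_dvd_imp_eq by auto
        then show ?thesis using eq q' q1 by simp
      next
        case 2
        then have "q' = q" using q'(1) q(1) primes_dvd_imp_eq by blast
        then have "s' = d ^ \<alpha>" using eq q1 by simp
        moreover have "d ^ \<alpha> > 1" using one_less_power[OF d1, of \<alpha>] \<alpha> by simp
        ultimately show ?thesis using s' by auto
      qed
    qed
    then have \<alpha>1: "\<alpha> = 1" using prime_power_iff by blast
    have s1: "s > 1" using sp prime_gt_1_nat by blast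
    have "{\<one>} \<subset> D"
      using subgroup.one_closed[OF D'] cD \<alpha>1 d1 by (auto)
    moreover have "D \<subset> ?N"
      using DN cN cD s1 d1 by (auto)
    ultimately obtain S where S: "solitary_subgroup S G" "{\<one>} \<subset> S" "S \<subset> ?N"
      using dense_between[OF triv_subgroup D' N] by blast
    have S': "subgroup S G" by (rule solitary_subgroup_imp_subgroup[OF S(1)])
    have "card S dvd d * s"
      using card_subgroup_dvd[OF S' N] S(3) cN \<alpha>1 by auto
    then obtain u v where uv: "card S = u * v" "u dvd d" "v dvd s"
      using division_decomp by blast
    have "u = 1 \<or> u = d" "v = 1 \<or> v = s"
      using uv d sp by (simp_all add: prime_nat_iff)
    moreover have "card S \<noteq> 1"
      using S(2) by (auto simp: card_1_singleton_iff)
    moreover have "card S \<noteq> d * s"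
      using subgroup_eqI[OF N, of S] S(3) cN \<alpha>1 by auto
    ultimately consider "card S = d" | "card S = s" using uv by auto
    then show False
    proof cases
      case 1
      then have "sylow_subgroup d S"
        using S' \<alpha>1 by (simp add: sylow_subgroup_def flip: \<alpha>_def)
      then show False
        using sylow_normal_unique[OF d _ solitary_imp_normal[OF S(1)] D(1)] D(2)
          solitary_imp_normal[OF S(1)] by simp
    next
      case 2
      then have "sylow_subgroup s S"
        using S' cP P by (simp add: sylow_subgroup_def)
      then show False
        using sylow_normal_unique[OF sp _ solitary_imp_normal[OF S(1)] P] nP
          solitary_imp_normal[OF S(1)] by simp
    qed
  qed
  obtain y where y: "y \<in> carrier G" "D = generate G {y}"
    using p_subgroup_cyclic[OF d D'] cD by blast
  have oy: "ord y = d ^ \<alpha>" using y cD card_generate by simp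
  \<comment> \<open>If \<open>s\<close> is not 1, the Sylow \<open>s\<close>-subgroup lies in
    \<open>?N\<close>, because it is normal and thus the only subgroup of its order, and
    \<open>?N\<close> has one of order \<open>s\<close>. Its generator commutes with that of
    \<open>D\<close>, and the product of the two has order \<open>card ?N\<close>.\<close>
  obtain b where b: "b \<in> carrier G" "?N = generate G {b}"
  proof (cases "s = 1")
    case True
    then have "D = ?N" using subgroup_eqI[OF N DN] cN cD by simp
    then show ?thesis using y that by simp
  next
    case False
    then have sp: "Factorial_Ring.prime s" using s by blast
    obtain P where P: "sylow_subgroup s P" using exists_sylow_subgroup[OF sp] .
    have P': "subgroup P G" by (rule sylow_subgroup_imp_subgroup[OF P])
    have cP: "card P = s" by (rule sylow_s[OF sp P])
    have Pn: "P \<lhd> G" by (rule Pnormal[OF sp P])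
    obtain R where R: "subgroup R G" "R \<subseteq> ?N" "card R = s"
      using exists_prime_power_subgroup[OF N sp, of 1] cN by auto
    then have "sylow_subgroup s R" using P cP by (simp add: sylow_subgroup_def)
    then have PN: "P \<subseteq> ?N" using sylow_normal_unique[OF sp P Pn] R by blast
    obtain z where z: "z \<in> carrier G" "P = generate G {z}"
      using p_subgroup_cyclic[OF sp P', of 1] cP by auto
    have oz: "ord z = s" using z cP card_generate by simp
    have yD: "y \<in> D" and zP: "z \<in> P" using y z generate_singleton_self by simp_all
    have "D \<inter> P = {\<one>}"
      using Int_coprime[OF D' P'] cD cP ds by simp
    then have yz: "y \<otimes> z = z \<otimes> y"
    proof (rule normalizing_imp_commuting[OF D' P'])
      show "z \<otimes> h \<otimes> inv z \<in> D" if "h \<in> D" for h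
        using that zP PN by (auto simp: normalizer_iff[OF D'])
    qed (use yD zP normal_conj_closed[OF Pn y(1)] in auto)
    then have "ord (y \<otimes> z) = d ^ \<alpha> * s"
      using ord_mult_coprime[OF y(1) z(1)] oy oz ds by simp
    moreover have "y \<otimes> z \<in> ?N"
      using yD zP DN PN by (intro subgroup.m_closed[OF N]) auto
    ultimately have "generate G {y \<otimes> z} = ?N"
      using cN y z by (intro subgroup_eqI[OF N generate_singleton_subset[OF N]]) (simp_all add: card_generate)
    then show ?thesis using that[of "y \<otimes> z"] y z by simp
  qed
  have ob: "ord b = d ^ \<alpha> * s" using b cN card_generate by simp
  obtain Q where Q: "sylow_subgroup q Q" using exists_sylow_subgroup[OF q(1)] .
  have Q': "subgroup Q G" by (rule sylow_subgroup_imp_subgroup[OF Q])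
  have "\<not> q dvd d ^ \<alpha> * s"
    using cop q(1) by (metis coprime_absorb_left dvd_refl not_prime_unit)
  then have "multiplicity q (q * (d ^ \<alpha> * s)) = 1"
    using q(1) d1 s0 by (subst multiplicity_times_same) (auto simp: not_dvd_imp_multiplicity_0)
  then have cQ: "card Q = q"
    using Q cG by (simp add: sylow_subgroup_def mult_ac)
  obtain a where a: "a \<in> carrier G" "Q = generate G {a}"
    using p_subgroup_cyclic[OF q(1) Q', of 1] cQ by auto
  have oa: "ord a = q" using a cQ card_generate by simp
  \<comment> \<open>If \<open>a\<close> commuted with \<open>b\<close>, it would centralize
    \<open>?N\<close> and with it \<open>D\<close>; so it would lie in \<open>?N\<close>, which
    meets \<open>Q\<close> trivially.\<close>
  have ab: "a \<otimes> b \<noteq> b \<otimes> a"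
  proof
    assume ab: "a \<otimes> b = b \<otimes> a"
    have "a \<otimes> x \<otimes> inv a = x" if "x \<in> ?N" for x
    proof -
      have "x \<in> {b [^] (i::nat) |i. True}"
        using that by (simp only: b(2) generate_singleton[OF b(1)])
      then obtain i where "x = b [^] (i::nat)" by blast
      moreover have "a \<otimes> b [^] i = b [^] i \<otimes> a" for i :: nat
        using group_commutes_pow[OF ab[symmetric] b(1) a(1), of i] by simp
      ultimately show ?thesis using a b by (simp add: m_assoc)
    qed
    then have "a \<in> ?N" using a(1) DN by (auto simp: normalizer_iff[OF D'])
    moreover have "Q \<inter> ?N = {\<one>}"
      using Int_coprime[OF Q' N] cQ cN cop by simp
    ultimately have "a = \<one>" using a generate_singleton_self by auto
    then show False using oa q1 by simp
  qed
  define c where "c = b [^] d"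
  have c: "c \<in> carrier G" using b by (simp add: c_def)
  have dob: "d dvd ord b" using ob \<alpha> by (simp add: dvd_power)
  have oc: "ord c = ord b div d" using ord_pow[OF b(1) dob] d1 by (simp add: c_def)
  have cN': "generate G {c} \<subseteq> ?N"
    using b generate_singleton_self[of b] subgroup_nat_pow_closed[OF N]
    by (intro generate_singleton_subset[OF N]) (auto simp: c_def)
  have C': "subgroup (generate G {c}) G" by (rule generate_singleton_subgroup[OF c])
  \<comment> \<open>For \<open>\<alpha> = 1\<close> this subgroup has order \<open>s\<close>, so it
    is trivial or a Sylow \<open>s\<close>-subgroup. For larger \<open>\<alpha>\<close> density is
    applied to the subgroup generated by \<open>b^(d*d)\<close> and \<open>?N\<close>.\<close>
  have Cn: "generate G {c} \<lhd> G"
  proof (cases "\<alpha> = 1")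
    case True
    then have ocs: "ord c = s" using oc ob d1 by simp
    show ?thesis
    proof (cases "s = 1")
      case True
      then have "c = \<one>" using ocs c ord_eq_1 by simp
      then show ?thesis using generate_one one_is_normal by simp
    next
      case False
      then have sp: "Factorial_Ring.prime s" using s by blast
      obtain P where P: "sylow_subgroup s P" using exists_sylow_subgroup[OF sp] .
      then have "sylow_subgroup s (generate G {c})"
        using sylow_s[OF sp P] C' ocs card_generate[OF c] by (simp add: sylow_subgroup_def)
      then show ?thesis by (rule Pnormal[OF sp])
    qed
  next
    case False
    then have "\<alpha> = Suc (Suc (\<alpha> - 2))" using \<alpha> by simp
    then obtain i where i: "\<alpha> = Suc (Suc i)" by blast
    define t where "t = d ^ i * s"
    have obt: "ord b = d * d * t" using ob i by (simp add: t_def)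
    have t0: "t > 0" using d1 s0 by (simp add: t_def)
    have oct: "ord c = d * t" using oc obt d1 by simp
    define e where "e = b [^] (d * d)"
    have e: "e \<in> carrier G" using b by (simp add: e_def)
    have oe: "ord e = t" using ord_pow[OF b(1), of "d * d"] obt d1 by (simp add: e_def)
    have E': "subgroup (generate G {e}) G" by (rule generate_singleton_subgroup[OF e])
    have "e = c [^] d" using b by (simp add: e_def c_def nat_pow_pow)
    then have "generate G {e} \<subseteq> generate G {c}"
      using generate_singleton_self[of c] subgroup_nat_pow_closed[OF C']
      by (intro generate_singleton_subset[OF C']) auto
    moreover have "generate G {e} \<noteq> generate G {c}"
      using card_generate[OF e] card_generate[OF c] oe oct t0 d1 by auto
    moreover have "generate G {c} \<noteq> ?N"
      using card_generate[OF c] cN ob obt oct t0 d1 by auto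
    \<comment> \<open>The lower end has index \<open>d * d\<close> in \<open>?N\<close>, so
      \<open>S\<close> is forced to have the order of \<open>generate G {c}\<close>, and the cyclic
      group \<open>?N\<close> has only one subgroup of that order.\<close>
    ultimately obtain S where S: "solitary_subgroup S G" "generate G {e} \<subset> S" "S \<subset> ?N"
      using dense_between[OF E' C' N] cN' by blast
    have S': "subgroup S G" by (rule solitary_subgroup_imp_subgroup[OF S(1)])
    obtain k where k: "card S = t * k"
      using card_subgroup_dvd[OF E' S'] S(2) oe card_generate[OF e] by auto
    have "card S dvd d * d * t"
      using card_subgroup_dvd[OF S' N] S(3) cN ob obt by auto
    then have "k dvd d ^ 2" using k t0 by (simp add: power2_eq_square mult.commute)
    then obtain j where j: "j \<le> 2" "k = d ^ j" using d divides_primepow_nat by blast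
    have "j \<noteq> 0"
      using subgroup_eqI[OF S', of "generate G {e}"] S(2) k j oe card_generate[OF e] by auto
    moreover have "j \<noteq> 2"
    proof
      assume "j = 2"
      then have "card S = ord b" using k j obt by (simp add: power2_eq_square)
      then have "S = ?N" using S(3) cN ob by (intro subgroup_eqI[OF N]) auto
      then show False using S(3) by blast
    qed
    ultimately have "j = 1" using j by simp
    then have "card S = card (generate G {c})"
      using k j oct card_generate[OF c] by simp
    then have "S = generate G {c}"
      using cyclic_subgroup_unique[OF b(1) S' _ C'] S(3) cN' b by auto
    then show ?thesis using solitary_imp_normal[OF S(1)] by simp
  qed
  have "ord c dvd d ^ \<alpha> * s" using ord_dvd_card[OF N] cN cN' generate_singleton_self[of c] by auto
  then have "coprime (card Q) (card (generate G {c}))"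
    using cop cQ card_generate[OF c] coprime_divisors[of q q "ord c" "d ^ \<alpha> * s"] by simp
  then have "Q \<inter> generate G {c} = {\<one>}" using Int_coprime[OF Q' C'] by simp
  then have "a \<otimes> c = c \<otimes> a"
    using normal_imp_commuting[OF Qnormal[OF Q] Cn, of a c] a generate_singleton_self by auto
  then show ?thesis
    using that[of q d s \<alpha> a b] q(1) d s sd \<alpha> cop cG a b oa ob Qnormal[OF Q] ab
    by (simp add: mult_ac c_def)
qed

end

section \<open>Solitary subgroups of metacyclic groups\<close>

context group
begin

text \<open>Failure of maximality is handed over as a witness \<open>L\<close>, which in several
  cases is itself the solitary subgroup sought.\<close>

lemma dense_solitary_subgroupsI:
  assumes "\<And>H L K. subgroup H G \<Longrightarrow> subgroup L G \<Longrightarrow> subgroup K G \<Longrightarrow> H \<subset> L \<Longrightarrow> L \<subset> K \<Longrightarrow>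
    \<exists>S. solitary_subgroup S G \<and> H \<subset> S \<and> S \<subset> K"
  shows "dense_solitary_subgroups G"
  unfolding dense_solitary_subgroups_def
proof (intro allI impI)
  fix H K
  assume HK: "subgroup H G \<and> subgroup K G \<and> H \<subset> K \<and> \<not> maximal_subgroup H (G\<lparr>carrier := K\<rparr>)"
  then obtain L where "subgroup L G" "H \<subseteq> L" "L \<subseteq> K" "L \<noteq> H" "L \<noteq> K"
    using maximal_subgroup_iff[of H K] by blast
  then show "\<exists>S. solitary_subgroup S G \<and> H \<subset> S \<and> S \<subset> K"
    using assms[of H L K] HK by blast
qed

lemma set_mult_mem: "x \<in> H \<Longrightarrow> y \<in> K \<Longrightarrow> x \<otimes> y \<in> H <#> K"
  by (auto simp: set_mult_def)

text \<open>Each \<open>b\<close> that moves to the left past a power of \<open>a\<close> multiplies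
  its exponent by \<open>r\<close>. This brings all products to the normal form
  \<open>b^j a^i\<close>.\<close>

lemma conj_rel_pow:
  fixes r :: nat
  assumes a: "a \<in> carrier G" and b: "b \<in> carrier G" and rel: "inv b \<otimes> a \<otimes> b = a [^] r"
  shows "a [^] (i::nat) \<otimes> b [^] (j::nat) = b [^] j \<otimes> a [^] (i * r ^ j)"
proof -
  have ab: "a \<otimes> b = b \<otimes> a [^] r"
  proof -
    have "b \<otimes> (inv b \<otimes> a \<otimes> b) = a \<otimes> b" using a b by (simp flip: m_assoc)
    then show ?thesis using rel by simp
  qed
  have 1: "a [^] i \<otimes> b = b \<otimes> a [^] (i * r)" for i :: nat
  proof (induction i)
    case (Suc i)
    have "a [^] Suc i \<otimes> b = a [^] i \<otimes> (a \<otimes> b)" using a b by (simp add: m_assoc)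
    also have "\<dots> = (a [^] i \<otimes> b) \<otimes> a [^] r" using a b by (simp add: ab m_assoc)
    also have "\<dots> = b \<otimes> a [^] (Suc i * r)"
      using a b by (simp add: Suc.IH m_assoc nat_pow_mult add.commute)
    finally show ?case .
  qed (use b in simp)
  show ?thesis
  proof (induction j arbitrary: i)
    case (Suc j)
    have "a [^] i \<otimes> b [^] Suc j = (a [^] i \<otimes> b [^] j) \<otimes> b" using a b by (simp add: m_assoc)
    also have "\<dots> = b [^] j \<otimes> (a [^] (i * r ^ j) \<otimes> b)" using a b by (simp add: Suc.IH m_assoc)
    also have "\<dots> = b [^] Suc j \<otimes> a [^] (i * r ^ Suc j)"
      using a b by (simp add: 1 m_assoc mult_ac)
    finally show ?case .
  qed (use a in simp)
qed

lemma conj_rel_mult: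
  fixes r :: nat and i j i' j' :: nat
  assumes a: "a \<in> carrier G" and b: "b \<in> carrier G" and rel: "inv b \<otimes> a \<otimes> b = a [^] r"
  shows "(b [^] j \<otimes> a [^] i) \<otimes> (b [^] j' \<otimes> a [^] i') = b [^] (j + j') \<otimes> a [^] (i * r ^ j' + i')"
proof -
  have "(b [^] j \<otimes> a [^] i) \<otimes> (b [^] j' \<otimes> a [^] i') = b [^] j \<otimes> (a [^] i \<otimes> b [^] j') \<otimes> a [^] i'"
    using a b by (simp add: m_assoc)
  also have "\<dots> = (b [^] j \<otimes> b [^] j') \<otimes> (a [^] (i * r ^ j') \<otimes> a [^] i')"
    using a b by (simp add: conj_rel_pow[OF a b rel] m_assoc)
  finally show ?thesis using a b by (simp add: nat_pow_mult)
qed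

text \<open>Modulo the powers of \<open>a\<close> only the exponent of \<open>b\<close> counts;
  \<open>l\<close> stays unspecified because the applications test only the
  \<open>b\<close>-exponent.\<close>

lemma conj_rel_power:
  fixes r :: nat and i j k :: nat
  assumes a: "a \<in> carrier G" and b: "b \<in> carrier G" and rel: "inv b \<otimes> a \<otimes> b = a [^] r"
  shows "\<exists>l::nat. (b [^] j \<otimes> a [^] i) [^] k = b [^] (j * k) \<otimes> a [^] l"
proof (induction k)
  case 0
  show ?case by (intro exI[of _ 0]) simp
next
  case (Suc k)
  then obtain l :: nat where "(b [^] j \<otimes> a [^] i) [^] k = b [^] (j * k) \<otimes> a [^] l" by blast
  then have "(b [^] j \<otimes> a [^] i) [^] Suc k = b [^] (j * k + j) \<otimes> a [^] (l * r ^ j + i)"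
    using conj_rel_mult[OF a b rel] by simp
  then show ?case by (auto simp: add.commute)
qed

lemma conj_rel_cong:
  fixes r j :: nat
  assumes a: "a \<in> carrier G" and b: "b \<in> carrier G" and rel: "inv b \<otimes> a \<otimes> b = a [^] r"
    and comm: "a \<otimes> b [^] j = b [^] j \<otimes> a"
  shows "[r ^ j = 1] (mod ord a)"
proof -
  have "b [^] j \<otimes> a [^] (r ^ j) = b [^] j \<otimes> a"
    using conj_rel_pow[OF a b rel, of 1 j] comm a by simp
  then have "a [^] (r ^ j) = a [^] (1::nat)" using a b by simp
  then have "a [^] int (r ^ j) = a [^] int 1" by (simp only: int_pow_int)
  then have "int (ord a) dvd int 1 - int (r ^ j)" using int_pow_eq[OF a] by blast
  then have "[int 1 = int (r ^ j)] (mod int (ord a))" by (simp only: cong_iff_dvd_diff)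
  then show ?thesis by (simp only: cong_int_iff cong_sym_eq)
qed

end

context finite_group
begin

text \<open>Isomorphic subgroups have equal order, and in a cyclic group the order determines the
  subgroup; so the intermediate \<open>L\<close> is already solitary.\<close>

lemma cyclic_imp_dense:
  assumes x: "x \<in> carrier G" and G: "carrier G = generate G {x}"
  shows "dense_solitary_subgroups G"
proof (rule dense_solitary_subgroupsI)
  fix H L K assume H: "subgroup H G" and L: "subgroup L G" and "subgroup K G" "H \<subset> L" "L \<subset> K"
  moreover have "solitary_subgroup L G"
    unfolding solitary_subgroup_def
  proof (intro conjI allI impI)
    fix M assume M: "subgroup M G \<and> G\<lparr>carrier := M\<rparr> \<cong> G\<lparr>carrier := L\<rparr>"
    then have "card M = card L"
      using iso_same_card[of "G\<lparr>carrier := M\<rparr>" "G\<lparr>carrier := L\<rparr>"] by simp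
    then show "M = L"
      using cyclic_subgroup_unique[OF x _ _ L] M L subgroup.subset G by metis
  qed (rule L)
  ultimately show "\<exists>S. solitary_subgroup S G \<and> H \<subset> S \<and> S \<subset> K" by blast
qed

end

text \<open>A quotient of \<open>ZM(q,n,r)\<close> in which \<open>a\<close> survives. The order of \<open>b\<close> may be a proper divisor of the
  exponent in its relation, which spares the computation of the order of the presented group.\<close>

locale ZM_presented = finite_group +
  fixes a b :: 'a and q r d p \<alpha> \<beta> :: nat
  assumes a [simp]: "a \<in> carrier G" and b [simp]: "b \<in> carrier G"
    and q: "Factorial_Ring.prime q" and a_ne: "a \<noteq> \<one>" and a_pow: "a [^] q = \<one>"
    and b_pow: "b [^] (d ^ \<alpha> * p ^ \<beta>) = \<one>"
    and rel: "inv b \<otimes> a \<otimes> b = a [^] r"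
    and span: "\<And>x. x \<in> carrier G \<Longrightarrow> \<exists>(j::nat) (i::nat). x = b [^] j \<otimes> a [^] i"
    and coprime_qn: "coprime q (d ^ \<alpha> * p ^ \<beta>)"
    and ord_r: "Pocklington.ord q r = d"
    and d: "Factorial_Ring.prime d" and p: "Factorial_Ring.prime p" and \<beta>: "\<beta> \<le> 1"
begin

abbreviation "Q \<equiv> generate G {a}"
abbreviation "B \<equiv> generate G {b}"
abbreviation "Z \<equiv> generate G {b [^] d}"
abbreviation "n \<equiv> ord b"

lemma q1: "q > 1" and d1: "d > 1"
  using q d prime_gt_1_nat by blast+

lemma ord_a: "ord a = q"
proof -
  have "ord a dvd q" using a_pow by (simp add: pow_eq_id)
  then show ?thesis using q a_ne ord_eq_1[OF a] by (auto simp: prime_nat_iff)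
qed

lemma n_dvd: "n dvd d ^ \<alpha> * p ^ \<beta>"
  using b_pow by (simp add: pow_eq_id)

lemma coprime_q_n: "coprime q n"
  using coprime_divisors[OF dvd_refl n_dvd coprime_qn] .

lemma Q_subgroup: "subgroup Q G" and B_subgroup: "subgroup B G" and Z_subgroup: "subgroup Z G"
  by (simp_all add: generate_singleton_subgroup)

lemma card_Q: "card Q = q" and card_B: "card B = n"
  by (simp_all add: card_generate ord_a)

lemma Q_Int_B: "Q \<inter> B = {\<one>}"
  using Int_coprime[OF Q_subgroup B_subgroup] card_Q card_B coprime_q_n by simp

lemma a_pow_mem: "a [^] (i::nat) \<in> Q" and b_pow_mem: "b [^] (i::nat) \<in> B"
  by (auto simp: generate_singleton)

lemma card_G: "card (carrier G) = q * n"
proof -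
  have "carrier G \<subseteq> B <#> Q"
  proof
    fix x assume "x \<in> carrier G"
    from span[OF this] obtain j i :: nat where "x = b [^] j \<otimes> a [^] i" by blast
    then show "x \<in> B <#> Q" using set_mult_mem[OF b_pow_mem a_pow_mem] by simp
  qed
  then have "carrier G = B <#> Q"
    using set_mult_least[OF subgroup_self subgroup.subset[OF B_subgroup] subgroup.subset[OF Q_subgroup]] by blast
  then show ?thesis
    using card_set_mult[OF B_subgroup Q_subgroup] Q_Int_B card_Q card_B by (simp add: Int_commute)
qed

lemma Q_normal: "Q \<lhd> G"
  unfolding normal_inv_iff
proof (intro conjI ballI)
  fix g x assume g: "g \<in> carrier G" and x: "x \<in> Q"
  obtain k :: nat where k: "x = a [^] k" using x by (auto simp: generate_singleton)
  obtain j i :: nat where ji: "inv g = b [^] j \<otimes> a [^] i"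
    using span[OF inv_closed[OF g]] by blast
  have "x \<otimes> inv g = inv g \<otimes> a [^] (k * r ^ j)"
  proof -
    have "x \<otimes> inv g = b [^] (0 + j) \<otimes> a [^] (k * r ^ j + i)"
      using conj_rel_mult[OF a b rel, of 0 k j i] k ji by simp
    also have "\<dots> = inv g \<otimes> a [^] (k * r ^ j)"
      by (simp add: ji m_assoc nat_pow_mult add.commute)
    finally show ?thesis .
  qed
  then have "g \<otimes> x \<otimes> inv g = a [^] (k * r ^ j)"
    using g k by (simp add: m_assoc) (simp flip: m_assoc)
  then show "g \<otimes> x \<otimes> inv g \<in> Q" using a_pow_mem by simp
qed (rule Q_subgroup)

text \<open>\<open>b^n = \<one>\<close> commutes with \<open>a\<close>, so \<open>r^n\<close> is 1
  modulo \<open>ord a = q\<close>. Hence the factor \<open>d\<close> survives in the actual order of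
  \<open>b\<close>.\<close>

lemma d_dvd_n: "d dvd n"
  using conj_rel_cong[OF a b rel, of n] ord_a ord_divides ord_r by simp

lemma Z_commute: "a [^] (i::nat) \<otimes> b [^] (d * m) = b [^] (d * m) \<otimes> a [^] i"
proof -
  have "[r ^ d = 1] (mod q)" using ord_divides[of r d q] ord_r by simp
  then have "[i * (r ^ d) ^ m = i * 1 ^ m] (mod q)" by (intro cong_mult cong_refl cong_pow)
  then have "a [^] (i * r ^ (d * m)) = a [^] i"
    using int_pow_eq[OF a, of "int (i * r ^ (d * m))" "int i"] ord_a
    by (simp add: power_mult) (metis cong_iff_dvd_diff cong_int_iff cong_sym int_pow_int of_nat_mult of_nat_power)
  then show ?thesis using conj_rel_pow[OF a b rel, of i "d * m"] by simp
qed

lemma Z_mem: "b [^] (d * m) \<in> Z"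
  by (auto simp: generate_singleton nat_pow_pow)

text \<open>The two factors commute, so the power \<open>k * n\<close> leaves only
  \<open>a^(i * k * n) = \<one>\<close>; since \<open>k * n\<close> is prime to \<open>q\<close>,
  already \<open>a^i\<close> is trivial.\<close>

lemma Z_memI:
  assumes x: "b [^] (d * m) \<otimes> a [^] (i::nat) = x" and k: "x [^] (k::nat) = \<one>" "coprime k q"
  shows "x \<in> Z"
proof -
  let ?u = "b [^] (d * m)"
  have xc: "x \<in> carrier G" using x by auto
  have "\<one> = x [^] (k * n)"
    using k xc by (simp flip: nat_pow_pow)
  also have "\<dots> = ?u [^] (k * n) \<otimes> a [^] (i * (k * n))"
    unfolding x[symmetric] using Z_commute[of i m]
    by (subst pow_mult_distrib) (simp_all add: nat_pow_pow)
  also have "?u [^] (k * n) = \<one>"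
    by (simp add: nat_pow_pow pow_eq_id)
  finally have "a [^] (i * (k * n)) = \<one>" by simp
  then have "q dvd i * (k * n)" using pow_eq_id[OF a] ord_a by simp
  then have "q dvd i"
    using k coprime_q_n by (simp add: coprime_dvd_mult_left_iff coprime_commute)
  then have "a [^] i = \<one>" by (simp add: pow_eq_id ord_a)
  then show ?thesis using x Z_mem by auto
qed

text \<open>Since \<open>Q\<close> and \<open>B\<close> meet trivially, \<open>y^k = \<one>\<close>
  forces \<open>n\<close> to divide \<open>j * k\<close>, and \<open>d * k dvd n\<close> then makes
  \<open>j\<close> a multiple of \<open>d\<close>. Conversely, for a subgroup \<open>H\<close> not
  inside \<open>Z\<close>, the product \<open>d * card H\<close> cannot divide
  \<open>n\<close>.\<close>

lemma root_mem_Z: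
  assumes y: "y \<in> carrier G" "y [^] (k::nat) = \<one>" and k: "d * k dvd n"
  shows "y \<in> Z"
proof -
  obtain j i :: nat where ji: "y = b [^] j \<otimes> a [^] i" using span[OF y(1)] by blast
  have "k > 0" using k ord_pos[OF b] by (cases k) auto
  obtain l :: nat where l: "y [^] k = b [^] (j * k) \<otimes> a [^] l"
    using conj_rel_power[OF a b rel] ji by blast
  then have "b [^] (j * k) = inv (a [^] l)"
    using y by (intro inv_equality[symmetric]) auto
  then have "b [^] (j * k) \<in> Q \<inter> B"
    using subgroup.m_inv_closed[OF Q_subgroup a_pow_mem] b_pow_mem[of "j * k"] by auto
  then have "n dvd j * k" using Q_Int_B by (simp add: pow_eq_id)
  then have "d dvd j" using k dvd_trans[of "d * k" n "j * k"] \<open>k > 0\<close> by simp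
  then obtain m where "j = d * m" by blast
  moreover have "coprime k q"
    using coprime_divisors[OF _ dvd_refl, of k n q] k coprime_q_n dvd_trans[of k "d * k" n]
    by (simp add: coprime_commute)
  ultimately show ?thesis using Z_memI[of m i y k] ji y by simp
qed

lemma card_Z: "card Z * d = n"
  using ord_pow[OF b d_dvd_n] d1 d_dvd_n by (simp add: card_generate)

text \<open>The order of a copy \<open>M\<close> divides \<open>card Z = n / d\<close>, so
  \<open>root_mem_Z\<close> puts \<open>M\<close> into the cyclic group \<open>Z\<close>, where the
  order determines it.\<close>

lemma subgroup_Z_solitary:
  assumes L: "subgroup L G" "L \<subseteq> Z"
  shows "solitary_subgroup L G"
  unfolding solitary_subgroup_def
proof (intro conjI allI impI)
  fix M assume M: "subgroup M G \<and> G\<lparr>carrier := M\<rparr> \<cong> G\<lparr>carrier := L\<rparr>"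
  then have c: "card M = card L"
    using iso_same_card[of "G\<lparr>carrier := M\<rparr>" "G\<lparr>carrier := L\<rparr>"] by simp
  have M': "subgroup M G" using M by blast
  have "card L dvd card Z" by (rule card_subgroup_dvd[OF L(1) Z_subgroup L(2)])
  then have "d * card M dvd n" using c card_Z by (metis mult.commute mult_dvd_mono dvd_refl)
  then have "M \<subseteq> Z"
    using root_mem_Z[of _ "card M"] pow_card_eq_one[OF M'] subgroup.mem_carrier[OF M'] by blast
  then show "M = L"
    using cyclic_subgroup_unique[of "b [^] d" M L] M' L c by simp
qed (rule L(1))

text \<open>A subgroup of order \<open>q\<close> lies in \<open>Q\<close>, because \<open>Q\<close>
  is normal of index \<open>n\<close> prime to \<open>q\<close>.\<close>

lemma Q_subset_iff:
  assumes K: "subgroup K G"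
  shows "Q \<subseteq> K \<longleftrightarrow> q dvd card K"
proof
  assume "Q \<subseteq> K"
  then show "q dvd card K" using card_subgroup_dvd[OF Q_subgroup K] card_Q by simp
next
  assume "q dvd card K"
  then obtain R where R: "subgroup R G" "R \<subseteq> K" "card R = q"
    using exists_prime_power_subgroup[OF K q, of 1] by auto
  have "R \<subseteq> Q"
  proof
    fix x assume x: "x \<in> R"
    show "x \<in> Q"
      using normal_coprime_mem[OF Q_normal, of x q n] pow_card_eq_one[OF R(1) x] R(3)
        subgroup.mem_carrier[OF R(1) x] card_G card_Q coprime_q_n by simp
  qed
  then have "R = Q" using subgroup_eqI[OF Q_subgroup] R card_Q by simp
  then show "Q \<subseteq> K" using R by simp
qed

text \<open>Containing \<open>Q\<close> is visible from the order, so a copy contains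
  \<open>Q\<close> too. A subgroup above \<open>Q\<close> is the product of \<open>Q\<close> with
  its intersection with the cyclic group \<open>B\<close>, and this intersection is determined by
  its order.\<close>

lemma supergroup_Q_solitary:
  assumes L: "subgroup L G" "Q \<subseteq> L"
  shows "solitary_subgroup L G"
  unfolding solitary_subgroup_def
proof (intro conjI allI impI)
  fix M assume M: "subgroup M G \<and> G\<lparr>carrier := M\<rparr> \<cong> G\<lparr>carrier := L\<rparr>"
  then have c: "card M = card L"
    using iso_same_card[of "G\<lparr>carrier := M\<rparr>" "G\<lparr>carrier := L\<rparr>"] by simp
  have M': "subgroup M G" using M by blast
  have QM: "Q \<subseteq> M" using Q_subset_iff[OF M'] Q_subset_iff[OF L(1)] L(2) c by simp
  have dec: "H = (H \<inter> B) <#> Q" if H: "subgroup H G" "Q \<subseteq> H" for H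
  proof
    show "(H \<inter> B) <#> Q \<subseteq> H" using H by (intro set_mult_least) auto
    show "H \<subseteq> (H \<inter> B) <#> Q"
    proof
      fix x assume x: "x \<in> H"
      obtain j i :: nat where ji: "x = b [^] j \<otimes> a [^] i"
        using span[OF subgroup.mem_carrier[OF H(1) x]] by blast
      have "b [^] j = x \<otimes> inv (a [^] i)" using ji by (simp add: m_assoc)
      also have "\<dots> \<in> H"
        using a_pow_mem[of i] H(2)
        by (intro subgroup.m_closed[OF H(1) x] subgroup.m_inv_closed[OF H(1)]) auto
      finally have "b [^] j \<in> H \<inter> B" using b_pow_mem by blast
      then show "x \<in> (H \<inter> B) <#> Q"
        using set_mult_mem[OF _ a_pow_mem] ji by simp
    qed
  qed
  have cardB: "card H = card (H \<inter> B) * q" if H: "subgroup H G" "Q \<subseteq> H" for H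
  proof -
    have "(H \<inter> B) \<inter> Q = {\<one>}"
      using Q_Int_B subgroup.one_closed[OF H(1)] by blast
    then show ?thesis
      using card_set_mult[OF subgroups_Inter_pair[OF H(1) B_subgroup] Q_subgroup] dec[OF H] card_Q by simp
  qed
  have "card (M \<inter> B) = card (L \<inter> B)"
    using cardB[OF L] cardB[OF M' QM] c q1 by simp
  then have "M \<inter> B = L \<inter> B"
    using cyclic_subgroup_unique[OF b subgroups_Inter_pair[OF M' B_subgroup] _ subgroups_Inter_pair[OF L(1) B_subgroup]] by simp
  then show "M = L" using dec[OF L] dec[OF M' QM] by simp
qed (rule L(1))

text \<open>The cofactor is prime to \<open>d\<close>, as a further factor \<open>d\<close> would
  make \<open>d * h\<close> divide \<open>n\<close>; so it divides \<open>p ^ \<beta>\<close>, and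
  thus \<open>p\<close> since \<open>\<beta> \<le> 1\<close>.\<close>

lemma cofactor_dvd_p:
  assumes "h dvd n" "\<not> d * h dvd n"
  shows "n div h dvd p"
proof -
  obtain w where w: "n = h * w" using assms by blast
  have h0: "h > 0" using w ord_pos[OF b] by (cases h) auto
  have "\<not> d dvd w" using assms w by (auto simp: mult.commute)
  then have "coprime w (d ^ \<alpha>)"
    using d by (simp add: prime_imp_coprime coprime_commute)
  moreover have "w dvd d ^ \<alpha> * p ^ \<beta>" using n_dvd w dvd_trans by (metis dvd_triv_right)
  ultimately have "w dvd p ^ \<beta>" by (simp add: coprime_dvd_mult_right_iff)
  also have "p ^ \<beta> dvd p" using \<beta> by (cases \<beta>) auto
  finally show ?thesis using w h0 by simp
qed

theorem dense: "dense_solitary_subgroups G"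
proof (rule dense_solitary_subgroupsI)
  fix H L K
  assume H: "subgroup H G" and L: "subgroup L G" and K: "subgroup K G" and HL: "H \<subset> L" and LK: "L \<subset> K"
  have cHL: "card H < card L" and cLK: "card L < card K"
    using psubset_card_mono[OF finite_subgroup[OF L] HL] psubset_card_mono[OF finite_subgroup[OF K] LK]
    by blast+
  show "\<exists>S. solitary_subgroup S G \<and> H \<subset> S \<and> S \<subset> K"
  proof (cases "Q \<subseteq> K")
    case QK: True
    show ?thesis
    proof (cases "Q \<subseteq> L")
      case True
      then show ?thesis using supergroup_Q_solitary[OF L] HL LK by blast
    next
      case False
      then have QH: "\<not> Q \<subseteq> H" using HL by blast
      have Int1: "Q \<inter> M = {\<one>}" if "subgroup M G" "\<not> Q \<subseteq> M" for M
        using that Q_subset_iff q card_Q prime_imp_coprime by (intro Int_coprime Q_subgroup) auto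
      have cQ: "card (Q <#> M) = q * card M" if "subgroup M G" "\<not> Q \<subseteq> M" for M
        using card_set_mult[OF Q_subgroup that(1)] Int1[OF that] card_Q by simp
      let ?S = "Q <#> H"
      have S: "subgroup ?S G" by (rule normal_set_mult_subgroup[OF Q_normal H])
      note up = set_mult_upper[OF Q_subgroup H]
      \<comment> \<open>The subgroup \<open>L\<close> enters only as a bound: \<open>?S\<close> has
        order \<open>q * card H\<close>, less than the order \<open>q * card L\<close> of
        \<open>Q <#> L\<close>, so it cannot be all of \<open>K\<close>.\<close>
      have "Q <#> L \<subseteq> K" using set_mult_least[OF K QK] LK by blast
      then have "q * card L \<le> card K"
        using cQ[OF L False] card_mono[OF finite_subgroup[OF K]] by metis
      moreover have "q * card H < q * card L" using cHL q1 by simp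
      ultimately have "?S \<noteq> K" using cQ[OF H QH] by auto
      moreover have "?S \<subseteq> K" using set_mult_least[OF K QK] HL LK by blast
      ultimately show ?thesis
        using supergroup_Q_solitary[OF S up(1)] up QH by blast
    qed
  next
    case QK: False
    have "card K dvd q * n" using card_subgroup_dvd[OF K subgroup_self subgroup.subset[OF K]] card_G by simp
    moreover have cKq: "coprime (card K) q"
      using Q_subset_iff[OF K] QK q prime_imp_coprime by (simp add: coprime_commute)
    ultimately have Kn: "card K dvd n" by (simp add: coprime_dvd_mult_right_iff)
    have K_Z: "b [^] (d * m) \<otimes> a [^] (i::nat) \<in> Z" if "b [^] (d * m) \<otimes> a [^] i \<in> K" for m i
      using Z_memI[OF HOL.refl pow_card_eq_one[OF K that] cKq] .
    show ?thesis
    proof (cases "L \<subseteq> Z")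
      case True
      then show ?thesis using subgroup_Z_solitary[OF L] HL LK by blast
    next
      case LZ: False
      show ?thesis
      proof (cases "H \<subseteq> Z")
        case True
        have KZ: "subgroup (K \<inter> Z) G" by (rule subgroups_Inter_pair[OF K Z_subgroup])
        \<comment> \<open>As \<open>L\<close> is not inside \<open>Z\<close>, the index of
          \<open>K \<inter> Z\<close> in \<open>K\<close> is the prime \<open>d\<close>, so equality
          with \<open>H\<close> would leave no room for \<open>L\<close>. Concretely, for
          \<open>l\<close> in \<open>L\<close> outside \<open>Z\<close> and any \<open>x\<close> in
          \<open>K\<close>, some \<open>l^t x\<close> lies in \<open>K \<inter> Z = H\<close>, which
          puts \<open>x\<close> into \<open>L\<close>.\<close>
        have "K \<inter> Z \<noteq> H"
        proof
          assume eq: "K \<inter> Z = H"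
          obtain l where l: "l \<in> L" "l \<notin> Z" using LZ by blast
          obtain x where x: "x \<in> K" "x \<notin> L" using LK by blast
          have lK: "l \<in> K" using l LK by blast
          obtain j i :: nat where ji: "l = b [^] j \<otimes> a [^] i"
            using span[OF subgroup.mem_carrier[OF L l(1)]] by blast
          obtain j' i' :: nat where ji': "x = b [^] j' \<otimes> a [^] i'"
            using span[OF subgroup.mem_carrier[OF K x(1)]] by blast
          have "\<not> d dvd j" using K_Z[of _ i] ji lK l(2) by (auto elim!: dvdE)
          then have "coprime j d" using d by (simp add: prime_imp_coprime coprime_commute)
          then obtain t' where t': "[j * t' = 1] (mod d)" using cong_solve_coprime_nat by auto
          \<comment> \<open>\<open>t \<equiv> - j' / j\<close> modulo \<open>d\<close>, so that \<open>l\<^sup>t x\<close> lies in \<open>Z\<close>\<close>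
          define t where "t = t' * (j' * (d - 1))"
          have "[j * t' * (j' * (d - 1)) + j' = 1 * (j' * (d - 1)) + j'] (mod d)"
            using t' by (intro cong_add cong_mult cong_refl)
          moreover have "1 * (j' * (d - 1)) + j' = j' * d"
            using d1 by (simp add: algebra_simps diff_mult_distrib2)
          ultimately have "d dvd j * t + j'"
            by (metis cong_dvd_iff dvd_triv_right mult.assoc t_def)
          then obtain m where m: "j * t + j' = d * m" by blast
          obtain k :: nat where k: "l [^] t = b [^] (j * t) \<otimes> a [^] k"
            using conj_rel_power[OF a b rel] ji by blast
          have "l [^] t \<otimes> x = b [^] (d * m) \<otimes> a [^] (k * r ^ j' + i')"
            using conj_rel_mult[OF a b rel] k ji' m by simp
          moreover have "l [^] t \<otimes> x \<in> K"
            using subgroup_nat_pow_closed[OF K lK] x by (intro subgroup.m_closed[OF K])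
          ultimately have "l [^] t \<otimes> x \<in> K \<inter> Z" using K_Z by auto
          then have lx: "l [^] t \<otimes> x \<in> L" using eq HL by blast
          have lt: "l [^] t \<in> L" by (rule subgroup_nat_pow_closed[OF L l(1)])
          have "inv (l [^] t) \<otimes> (l [^] t \<otimes> x) \<in> L"
            by (rule subgroup.m_closed[OF L subgroup.m_inv_closed[OF L lt] lx])
          moreover have "inv (l [^] t) \<otimes> (l [^] t \<otimes> x) = x"
            using subgroup.mem_carrier[OF L lt] subgroup.mem_carrier[OF K x(1)] by (simp flip: m_assoc)
          ultimately show False using x by simp
        qed
        moreover have "solitary_subgroup (K \<inter> Z) G" by (rule subgroup_Z_solitary[OF KZ]) simp
        ultimately show ?thesis using True HL LK LZ by blast
      next
        case False
        \<comment> \<open>This case is void: \<open>u\<close> and \<open>v\<close> are the indices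
          of \<open>H\<close> in \<open>L\<close> and of \<open>L\<close> in \<open>K\<close>, both
          greater than 1, while their product divides the prime \<open>p\<close>.\<close>
        obtain u where u: "card L = card H * u" using card_subgroup_dvd[OF H L] HL by blast
        obtain v where v: "card K = card L * v" using card_subgroup_dvd[OF L K] LK by blast
        obtain w where w: "n = card K * w" using Kn by blast
        have uv: "u > 1" "v > 1" using cHL cLK u v by (cases u; cases v; auto)+
        have "\<not> d * card H dvd n"
          using False root_mem_Z[of _ "card H"] pow_card_eq_one[OF H] subgroup.mem_carrier[OF H] by blast
        moreover have "card H dvd n" using u v w by simp
        ultimately have "n div card H dvd p" by (rule cofactor_dvd_p[rotated])
        moreover have "n div card H = u * (v * w)"
          using u v w card_subgroup_pos[OF H] by simp
        ultimately have "u * v dvd p" by (metis dvd_mult_left mult.assoc)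
        then have "u * v \<le> p" and "u dvd p"
          using p by (auto dest: dvd_imp_le dvd_mult_left simp: prime_gt_0_nat)
        moreover have "u = p" using \<open>u dvd p\<close> p uv by (auto simp: prime_nat_iff)
        ultimately show ?thesis using uv by simp
      qed
    qed
  qed
qed

end

section \<open>The presentation of \<open>ZM(m,n,r)\<close>\<close>

fun eval_word :: "('a, 'b) monoid_scheme \<Rightarrow> ('g \<Rightarrow> 'a) \<Rightarrow> 'g word \<Rightarrow> 'a" where
  "eval_word G f [] = \<one>\<^bsub>G\<^esub>"
| "eval_word G f ((x, e) # w) = (if e then f x else inv\<^bsub>G\<^esub> f x) \<otimes>\<^bsub>G\<^esub> eval_word G f w"

context group
begin

lemma eval_word_closed: "\<forall>x. f x \<in> carrier G \<Longrightarrow> eval_word G f w \<in> carrier G"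
  by (induction w) auto

lemma eval_word_append:
  "\<forall>x. f x \<in> carrier G \<Longrightarrow> eval_word G f (u @ v) = eval_word G f u \<otimes> eval_word G f v"
  by (induction u) (auto simp: m_assoc eval_word_closed)

lemma eval_word_replicate:
  "\<forall>x. f x \<in> carrier G \<Longrightarrow> eval_word G f (replicate k (x, True)) = f x [^] k"
proof (induction k)
  case (Suc k)
  then show ?case using nat_pow_Suc2[of "f x" k] by simp
qed simp

lemma eval_word_eq:
  assumes uv: "word_eq R u v" and f: "\<forall>x. f x \<in> carrier G"
    and R: "\<And>u v. (u, v) \<in> R \<Longrightarrow> eval_word G f u = eval_word G f v"
  shows "eval_word G f u = eval_word G f v"
  using uv
proof induction
  case (append u u' v v')
  then show ?case by (simp add: eval_word_append[OF f])
next
  case (cancel x e)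
  then show ?case using f by auto
qed (use R in auto)

text \<open>Von Dyck's theorem: \<open>h\<close> evaluates an arbitrary representative of a class,
  and by \<open>eval_word_eq\<close> the choice does not affect the value.\<close>

lemma presented_group_hom:
  assumes f: "\<forall>x. f x \<in> carrier G"
    and R: "\<And>u v. (u, v) \<in> R \<Longrightarrow> eval_word G f u = eval_word G f v"
  obtains h where "h \<in> hom (presented_group R) G" "\<And>u. h (word_class R u) = eval_word G f u"
proof -
  define h where "h A = eval_word G f (SOME u. u \<in> A)" for A
  have h: "h (word_class R u) = eval_word G f u" for u
  proof -
    have "u \<in> word_class R u" by (simp add: word_class_def word_eq.refl)
    then have "(SOME v. v \<in> word_class R u) \<in> word_class R u" by (rule someI)
    then have "word_eq R u (SOME v. v \<in> word_class R u)" by (simp add: word_class_def)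
    then show ?thesis
      unfolding h_def using eval_word_eq[OF _ f R] by metis
  qed
  moreover have "h \<in> hom (presented_group R) G"
  proof (rule homI)
    fix A C assume "A \<in> carrier (presented_group R)"
    then obtain u where u: "A = word_class R u" by (auto simp: presented_group_def)
    show "h A \<in> carrier G" by (simp add: u h eval_word_closed[OF f])
    assume "C \<in> carrier (presented_group R)"
    then obtain v where v: "C = word_class R v" by (auto simp: presented_group_def)
    show "h (A \<otimes>\<^bsub>presented_group R\<^esub> C) = h A \<otimes> h C"
      by (simp add: u v h mult_presented_group eval_word_append[OF f])
  qed
  ultimately show ?thesis using that by blast
qed

end

abbreviation ZM_a :: "nat \<Rightarrow> nat \<Rightarrow> nat \<Rightarrow> ZM_gen word set" where
  "ZM_a m n r \<equiv> word_class (ZM_relations m n r) [(Gen_a, True)]"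

abbreviation ZM_b :: "nat \<Rightarrow> nat \<Rightarrow> nat \<Rightarrow> ZM_gen word set" where
  "ZM_b m n r \<equiv> word_class (ZM_relations m n r) [(Gen_b, True)]"

lemma group_ZM: "group (ZM m n r)"
  unfolding ZM_def by (rule group_presented_group)

lemma word_class_carrier: "word_class R u \<in> carrier (presented_group R)"
  by (simp add: presented_group_def)

lemma word_class_replicate:
  "word_class R (replicate k (x, e)) = word_class R [(x, e)] [^]\<^bsub>presented_group R\<^esub> k"
proof (induction k)
  case 0
  show ?case by (simp add: presented_group_def)
next
  case (Suc k)
  have "word_class R (replicate (Suc k) (x, e)) = word_class R (replicate k (x, e) @ [(x, e)])"
    by (simp add: replicate_append_same)
  then show ?case by (simp add: mult_presented_group flip: Suc.IH)
qed

lemma word_class_False: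
  "word_class R [(x, False)] = inv\<^bsub>presented_group R\<^esub> word_class R [(x, True)]"
proof -
  interpret P: group "presented_group R" by (rule group_presented_group)
  have "word_class R [(x, False)] \<otimes>\<^bsub>presented_group R\<^esub> word_class R [(x, True)] = word_class R []"
    using word_eq.cancel[of R x False] by (simp add: mult_presented_group word_class_eq_iff)
  also have "\<dots> = \<one>\<^bsub>presented_group R\<^esub>" by (simp add: presented_group_def)
  finally show ?thesis by (intro P.inv_equality[symmetric] word_class_carrier)
qed

lemma ZM_generators:
  shows "ZM_a m n r \<in> carrier (ZM m n r)" and "ZM_b m n r \<in> carrier (ZM m n r)"
    and "ZM_a m n r [^]\<^bsub>ZM m n r\<^esub> m = \<one>\<^bsub>ZM m n r\<^esub>"
    and "ZM_b m n r [^]\<^bsub>ZM m n r\<^esub> n = \<one>\<^bsub>ZM m n r\<^esub>"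
    and "inv\<^bsub>ZM m n r\<^esub> ZM_b m n r \<otimes>\<^bsub>ZM m n r\<^esub> ZM_a m n r \<otimes>\<^bsub>ZM m n r\<^esub> ZM_b m n r
      = ZM_a m n r [^]\<^bsub>ZM m n r\<^esub> r"
proof -
  let ?R = "ZM_relations m n r"
  have rel: "word_class ?R u = word_class ?R v" if "(u, v) \<in> ?R" for u v
    using word_eq.relation[OF that] by (simp add: word_class_eq_iff)
  have one: "\<one>\<^bsub>presented_group ?R\<^esub> = word_class ?R []" by (simp add: presented_group_def)
  show "ZM_a m n r \<in> carrier (ZM m n r)" "ZM_b m n r \<in> carrier (ZM m n r)"
    by (simp_all add: ZM_def word_class_carrier)
  show "ZM_a m n r [^]\<^bsub>ZM m n r\<^esub> m = \<one>\<^bsub>ZM m n r\<^esub>" "ZM_b m n r [^]\<^bsub>ZM m n r\<^esub> n = \<one>\<^bsub>ZM m n r\<^esub>"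
    unfolding ZM_def one word_class_replicate[symmetric] by (rule rel; simp add: ZM_relations_def)+
  show "inv\<^bsub>ZM m n r\<^esub> ZM_b m n r \<otimes>\<^bsub>ZM m n r\<^esub> ZM_a m n r \<otimes>\<^bsub>ZM m n r\<^esub> ZM_b m n r
      = ZM_a m n r [^]\<^bsub>ZM m n r\<^esub> r"
    unfolding ZM_def word_class_replicate[symmetric] word_class_False[symmetric] mult_presented_group
    by (rule rel) (simp add: ZM_relations_def)
qed

text \<open>Both generators have finite order, so inverse letters are nonnegative powers;
  \<open>conj_rel_mult\<close> then merges the letters of a word into one normal form.\<close>

lemma ZM_span:
  assumes mn: "m > 0" "n > 0" and x: "x \<in> carrier (ZM m n r)"
  shows "\<exists>(j::nat) (i::nat). x = ZM_b m n r [^]\<^bsub>ZM m n r\<^esub> j \<otimes>\<^bsub>ZM m n r\<^esub> ZM_a m n r [^]\<^bsub>ZM m n r\<^esub> i"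
proof -
  let ?R = "ZM_relations m n r"
  interpret P: group "ZM m n r" by (rule group_ZM)
  note gen = ZM_generators[of m n r]
  have inv_pow: "inv\<^bsub>ZM m n r\<^esub> y = y [^]\<^bsub>ZM m n r\<^esub> (k - 1)"
    if "y \<in> carrier (ZM m n r)" "y [^]\<^bsub>ZM m n r\<^esub> k = \<one>\<^bsub>ZM m n r\<^esub>" "k > 0" for y and k :: nat
  proof (rule P.inv_equality)
    have "y [^]\<^bsub>ZM m n r\<^esub> (k - 1) \<otimes>\<^bsub>ZM m n r\<^esub> y = y [^]\<^bsub>ZM m n r\<^esub> Suc (k - 1)" by simp
    then show "y [^]\<^bsub>ZM m n r\<^esub> (k - 1) \<otimes>\<^bsub>ZM m n r\<^esub> y = \<one>\<^bsub>ZM m n r\<^esub>" using that by simp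
  qed (use that in auto)
  have letter: "\<exists>(j::nat) (i::nat). word_class ?R [l] = ZM_b m n r [^]\<^bsub>ZM m n r\<^esub> j \<otimes>\<^bsub>ZM m n r\<^esub> ZM_a m n r [^]\<^bsub>ZM m n r\<^esub> i" for l
  proof -
    obtain x e where l: "l = (x, e)" by fastforce
    have pow: "\<exists>k::nat. word_class ?R [(x, e)] = word_class ?R [(x, True)] [^]\<^bsub>ZM m n r\<^esub> k"
    proof (cases e)
      case True
      then show ?thesis using gen by (intro exI[of _ 1]) (cases x; simp)
    next
      case False
      then have "word_class ?R [(x, e)] = inv\<^bsub>ZM m n r\<^esub> word_class ?R [(x, True)]"
        by (simp add: word_class_False ZM_def)
      then show ?thesis
        using inv_pow[OF gen(1,3) mn(1)] inv_pow[OF gen(2,4) mn(2)] by (cases x) auto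
    qed
    then obtain k :: nat where k: "word_class ?R [(x, e)] = word_class ?R [(x, True)] [^]\<^bsub>ZM m n r\<^esub> k" by blast
    show ?thesis
    proof (cases x)
      case Gen_a
      then show ?thesis using k l gen by (intro exI[of _ 0] exI[of _ k]) simp
    next
      case Gen_b
      then show ?thesis using k l gen by (intro exI[of _ k] exI[of _ 0]) simp
    qed
  qed
  have "\<exists>(j::nat) (i::nat). word_class ?R u = ZM_b m n r [^]\<^bsub>ZM m n r\<^esub> j \<otimes>\<^bsub>ZM m n r\<^esub> ZM_a m n r [^]\<^bsub>ZM m n r\<^esub> i" for u
  proof (induction u)
    case Nil
    have "word_class ?R [] = \<one>\<^bsub>ZM m n r\<^esub>" by (simp add: ZM_def presented_group_def)
    then show ?case using gen by (intro exI[of _ 0]) simp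
  next
    case (Cons l u)
    then obtain j i j' i' :: nat
      where "word_class ?R u = ZM_b m n r [^]\<^bsub>ZM m n r\<^esub> j \<otimes>\<^bsub>ZM m n r\<^esub> ZM_a m n r [^]\<^bsub>ZM m n r\<^esub> i"
        and "word_class ?R [l] = ZM_b m n r [^]\<^bsub>ZM m n r\<^esub> j' \<otimes>\<^bsub>ZM m n r\<^esub> ZM_a m n r [^]\<^bsub>ZM m n r\<^esub> i'"
      using letter[of l] by blast
    moreover have "word_class ?R (l # u) = word_class ?R [l] \<otimes>\<^bsub>ZM m n r\<^esub> word_class ?R u"
      by (simp add: ZM_def mult_presented_group)
    ultimately have "word_class ?R (l # u) = ZM_b m n r [^]\<^bsub>ZM m n r\<^esub> (j' + j) \<otimes>\<^bsub>ZM m n r\<^esub>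
        ZM_a m n r [^]\<^bsub>ZM m n r\<^esub> (i' * r ^ j + i)"
      using P.conj_rel_mult[OF gen(1,2,5)] by simp
    then show ?case by blast
  qed
  then show ?thesis using x by (auto simp: ZM_def presented_group_def)
qed

text \<open>The exponents of the normal form can be reduced modulo \<open>n\<close> and
  \<open>m\<close>. In \<open>iso_ZM\<close> a homomorphism onto a group of order
  \<open>m * n\<close> supplies the opposite bound.\<close>

lemma card_ZM_le:
  assumes mn: "m > 0" "n > 0"
  shows "finite (carrier (ZM m n r))" "card (carrier (ZM m n r)) \<le> m * n"
proof -
  interpret P: group "ZM m n r" by (rule group_ZM)
  note gen = ZM_generators[of m n r]
  let ?f = "\<lambda>(j::nat, i::nat). ZM_b m n r [^]\<^bsub>ZM m n r\<^esub> j \<otimes>\<^bsub>ZM m n r\<^esub> ZM_a m n r [^]\<^bsub>ZM m n r\<^esub> i"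
  have mod: "y [^]\<^bsub>ZM m n r\<^esub> i = y [^]\<^bsub>ZM m n r\<^esub> (i mod k)"
    if y: "y \<in> carrier (ZM m n r)" "y [^]\<^bsub>ZM m n r\<^esub> k = \<one>\<^bsub>ZM m n r\<^esub>" for y and i k :: nat
  proof -
    have "y [^]\<^bsub>ZM m n r\<^esub> (k * (i div k) + i mod k) = (y [^]\<^bsub>ZM m n r\<^esub> k) [^]\<^bsub>ZM m n r\<^esub> (i div k) \<otimes>\<^bsub>ZM m n r\<^esub> y [^]\<^bsub>ZM m n r\<^esub> (i mod k)"
      using y(1) by (simp only: P.nat_pow_mult P.nat_pow_pow)
    then show ?thesis using y by simp
  qed
  have sub: "carrier (ZM m n r) \<subseteq> ?f ` ({..<n} \<times> {..<m})"
  proof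
    fix x assume "x \<in> carrier (ZM m n r)"
    from ZM_span[OF mn this] obtain j i :: nat where
      "x = ZM_b m n r [^]\<^bsub>ZM m n r\<^esub> j \<otimes>\<^bsub>ZM m n r\<^esub> ZM_a m n r [^]\<^bsub>ZM m n r\<^esub> i" by blast
    then have "x = ?f (j mod n, i mod m)"
      using mod[OF gen(1,3), of i] mod[OF gen(2,4), of j] by simp
    then show "x \<in> ?f ` ({..<n} \<times> {..<m})" using mn by (intro image_eqI) auto
  qed
  show "finite (carrier (ZM m n r))" by (rule finite_subset[OF sub]) simp
  have "card (carrier (ZM m n r)) \<le> card ({..<n} \<times> {..<m})"
    by (rule surj_card_le[OF _ sub]) simp
  then show "card (carrier (ZM m n r)) \<le> m * n" by (simp add: mult.commute)
qed

text \<open>The homomorphism from the presentation attains \<open>a\<close> and \<open>b\<close>,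
  whose orders are coprime, so its image has at least \<open>m * n\<close> elements and is
  everything; \<open>card_ZM_le\<close> makes it injective.\<close>

lemma (in finite_group) iso_ZM:
  assumes a: "a \<in> carrier G" and b: "b \<in> carrier G" and rel: "inv b \<otimes> a \<otimes> b = a [^] (r::nat)"
    and m: "ord a = m" and n: "ord b = n" and cop: "coprime m n" and card: "card (carrier G) = m * n"
  shows "G \<cong> ZM m n r"
proof -
  let ?f = "\<lambda>x. case x of Gen_a \<Rightarrow> a | Gen_b \<Rightarrow> b"
  have mn: "m > 0" "n > 0" using a b m n ord_pos by auto
  have f: "\<forall>x. ?f x \<in> carrier G" using a b by (auto split: ZM_gen.splits)
  have "eval_word G ?f u = eval_word G ?f v" if "(u, v) \<in> ZM_relations m n r" for u v
  proof -
    have "a [^] m = \<one>" "b [^] n = \<one>" using a b m n by auto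
    then show ?thesis
      using that a b rel by (auto simp: ZM_relations_def eval_word_replicate[OF f] m_assoc)
  qed
  from presented_group_hom[OF f this] obtain h where h: "h \<in> hom (ZM m n r) G"
    and h_eq: "\<And>u. h (word_class (ZM_relations m n r) u) = eval_word G ?f u"
    unfolding ZM_def by blast
  interpret h: group_hom "ZM m n r" G h
    using h group_ZM by (simp add: group_hom_def group_hom_axioms_def)
  let ?I = "h ` carrier (ZM m n r)"
  have I: "subgroup ?I G" by (rule h.img_is_subgroup)
  have "h (ZM_a m n r) = a" "h (ZM_b m n r) = b" using a b by (simp_all add: h_eq)
  then have "a \<in> ?I" "b \<in> ?I" using ZM_generators(1,2)[of m n r] by (metis imageI)+
  then have "m * n dvd card ?I"
    using ord_dvd_card[OF I] m n cop by (auto intro: divides_mult)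
  then have "m * n \<le> card ?I" using card_subgroup_pos[OF I] by (rule dvd_imp_le)
  then have surj: "?I = carrier G"
    using subgroup_eqI[OF subgroup_self subgroup.subset[OF I]] card by simp
  then have "inj_on h (carrier (ZM m n r))"
    using card_ZM_le[OF mn, of r] card card_image_le[of "carrier (ZM m n r)" h]
    by (intro eq_card_imp_inj_on) auto
  then have "h \<in> iso (ZM m n r) G"
    using h surj by (simp add: iso_def bij_betw_def)
  then show ?thesis
    using group.iso_sym[OF group_ZM] is_isoI by blast
qed

section \<open>From the structure of the group to the parameters of the presentation, and
  back\<close>

lemma (in dense_group) noncyclic_imp_ZM:
  assumes nc: "\<not> cyclic_group G"
  shows "\<exists>m n r d p \<alpha> \<beta> :: nat.
       ZM_triple m n r \<and> G \<cong> ZM m n r \<and>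
       Factorial_Ring.prime m \<and> d = Pocklington.ord m r \<and> Factorial_Ring.prime d \<and>
       n = d ^ \<alpha> * p ^ \<beta> \<and> Factorial_Ring.prime p \<and> p \<noteq> d \<and> \<alpha> \<ge> 1 \<and> \<beta> \<in> {0, 1}"
proof -
  obtain q d s \<alpha> a b where q: "Factorial_Ring.prime q" and d: "Factorial_Ring.prime d"
    and s: "s = 1 \<or> Factorial_Ring.prime s" "s \<noteq> d" and \<alpha>: "\<alpha> \<ge> 1"
    and cop: "coprime q (d ^ \<alpha> * s)" and card: "card (carrier G) = q * (d ^ \<alpha> * s)"
    and a: "a \<in> carrier G" and b: "b \<in> carrier G" and oa: "ord a = q" and ob: "ord b = d ^ \<alpha> * s"
    and Q: "generate G {a} \<lhd> G" and ab: "a \<otimes> b \<noteq> b \<otimes> a" and abd: "a \<otimes> b [^] d = b [^] d \<otimes> a"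
    by (rule noncyclic_structure[OF nc])
  have q1: "q > 1" using q prime_gt_1_nat by blast
  have "inv b \<otimes> a \<otimes> b \<in> generate G {a}"
    using normal_conj_closed[OF Q inv_closed[OF b] generate_singleton_self] b by simp
  then obtain k :: nat where k: "inv b \<otimes> a \<otimes> b = a [^] k"
    using generate_singleton[OF a] by auto
  \<comment> \<open>The reduction modulo \<open>q\<close> yields \<open>1 < r < q\<close>, once
    \<open>a \<noteq> \<one>\<close> excludes 0 and noncommutation excludes 1; this makes
    \<open>r - 1\<close> prime to \<open>q\<close>.\<close>
  define r where "r = k mod q"
  have "a [^] (q * (k div q) + k mod q) = (a [^] q) [^] (k div q) \<otimes> a [^] (k mod q)"
    using a by (simp only: nat_pow_mult nat_pow_pow nat_pow_closed)
  then have rel: "inv b \<otimes> a \<otimes> b = a [^] r"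
    using k a oa pow_ord_eq_1[OF a] by (simp add: r_def)
  have b_rel: "a \<otimes> b = b \<otimes> a [^] r"
    using conj_rel_pow[OF a b rel, of 1 1] a b by simp
  have "r \<noteq> 0"
  proof
    assume "r = 0"
    then have "a \<otimes> b = \<one> \<otimes> b" using b_rel b by simp
    then have "a = \<one>" using a b by simp
    then show False using oa q1 by simp
  qed
  moreover have "r \<noteq> 1" using b_rel ab a by auto
  ultimately have r: "1 < r" "r < q" using q1 by (auto simp: r_def)
  have "\<not> q dvd r - 1" using r by (auto dest: dvd_imp_le)
  then have gcd: "gcd q (r - 1) = 1" using q by (simp add: prime_imp_coprime)
  have rn: "[r ^ (d ^ \<alpha> * s) = 1] (mod q)"
    using conj_rel_cong[OF a b rel, of "ord b"] a pow_ord_eq_1[OF b] unfolding oa ob by simp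
  have "Pocklington.ord q r dvd d"
    using conj_rel_cong[OF a b rel abd] oa ord_divides by simp
  moreover have "Pocklington.ord q r \<noteq> 1"
  proof
    assume "Pocklington.ord q r = 1"
    then have "[r ^ 1 = 1] (mod q)" by (simp only: ord_divides dvd_refl)
    then show False using r q1 by (simp add: cong_def)
  qed
  ultimately have ordr: "d = Pocklington.ord q r" using d by (auto simp: prime_nat_iff)
  \<comment> \<open>For \<open>s = 1\<close> the exponent \<open>\<beta>\<close> is 0 and
    \<open>p\<close> may be any prime other than \<open>d\<close>; a larger prime is taken.\<close>
  obtain p \<beta> where p: "Factorial_Ring.prime p" "p \<noteq> d" "s = p ^ \<beta>" "\<beta> \<in> {0, 1}"
  proof (cases "s = 1")
    case True
    obtain p where "Factorial_Ring.prime p" "d < p" using bigger_prime by blast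
    then show ?thesis using True that[of p 0] by simp
  next
    case False
    then show ?thesis using s that[of s 1] by auto
  qed
  have "ZM_triple q (d ^ \<alpha> * s) r"
    using q1 r gcd rn cop ord_pos[OF b] ob by (simp add: ZM_triple_def)
  moreover have "G \<cong> ZM q (d ^ \<alpha> * s) r"
    by (rule iso_ZM[OF a b rel oa ob cop card])
  ultimately show ?thesis
    using q d ordr p \<alpha> by blast
qed

lemma (in finite_group) ZM_imp_dense:
  assumes zm: "ZM_triple m n r" and iso: "G \<cong> ZM m n r"
    and m: "Factorial_Ring.prime m" and d: "d = Pocklington.ord m r" "Factorial_Ring.prime d"
    and n: "n = d ^ \<alpha> * p ^ \<beta>" and p: "Factorial_Ring.prime p" and \<beta>: "\<beta> \<in> {0, 1}"
  shows "dense_solitary_subgroups G"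
proof -
  have mn: "m > 0" "n > 0" using zm by (auto simp: ZM_triple_def)
  obtain h where h: "h \<in> iso (ZM m n r) G"
    using iso_sym[OF iso] by (auto simp: is_iso_def)
  interpret h: group_hom "ZM m n r" G h
    using h group_ZM by (simp add: group_hom_def group_hom_axioms_def iso_def)
  note gen = ZM_generators[of m n r]
  define a where "a = h (ZM_a m n r)"
  define b where "b = h (ZM_b m n r)"
  have a: "a \<in> carrier G" and b: "b \<in> carrier G"
    using gen by (simp_all add: a_def b_def)
  have am: "a [^] m = \<one>" and bn: "b [^] n = \<one>"
    using gen by (simp_all add: a_def b_def flip: h.hom_nat_pow)
  have rel: "inv b \<otimes> a \<otimes> b = a [^] r"
    using arg_cong[OF gen(5), of h] gen(1,2) by (simp add: a_def b_def h.hom_nat_pow)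
  have span: "\<exists>(j::nat) (i::nat). x = b [^] j \<otimes> a [^] i" if "x \<in> carrier G" for x
  proof -
    have "x \<in> h ` carrier (ZM m n r)"
      using h that by (simp add: iso_def bij_betw_def)
    then obtain y where y: "y \<in> carrier (ZM m n r)" "x = h y" by blast
    from ZM_span[OF mn y(1)] obtain j i :: nat where
      "y = ZM_b m n r [^]\<^bsub>ZM m n r\<^esub> j \<otimes>\<^bsub>ZM m n r\<^esub> ZM_a m n r [^]\<^bsub>ZM m n r\<^esub> i" by blast
    then have "x = b [^] j \<otimes> a [^] i"
      using gen(1,2) y by (simp add: a_def b_def h.hom_nat_pow)
    then show ?thesis by blast
  qed
  \<comment> \<open>A collapse of \<open>a\<close> in the presented group has not been ruled out at
    this point. If it occurs, \<open>b\<close> alone generates \<open>G\<close>, and the cyclic case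
    applies.\<close>
  show ?thesis
  proof (cases "a = \<one>")
    case True
    have "carrier G \<subseteq> generate G {b}"
    proof
      fix x assume "x \<in> carrier G"
      from span[OF this] obtain j i :: nat where "x = b [^] j \<otimes> a [^] i" by blast
      then have "x = b [^] j" using True b by simp
      then show "x \<in> generate G {b}" using generate_singleton[OF b] by blast
    qed
    then have "carrier G = generate G {b}"
      using subgroup.subset[OF generate_singleton_subgroup[OF b]] by blast
    then show ?thesis by (rule cyclic_imp_dense[OF b])
  next
    case False
    have cop: "coprime m (d ^ \<alpha> * p ^ \<beta>)"
      using zm unfolding ZM_triple_def n coprime_iff_gcd_eq_1 by (elim conjE)
    have bn': "b [^] (d ^ \<alpha> * p ^ \<beta>) = \<one>" using bn n by simp
    have \<beta>1: "\<beta> \<le> 1" using \<beta> by auto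
    interpret ZM_presented G a b m r d p \<alpha> \<beta>
      by unfold_locales (fact a b m False am bn' rel span cop d(1)[symmetric] d(2) p \<beta>1)+
    show ?thesis by (rule dense)
  qed
qed

lemma (in finite_group) cyclic_group_imp_dense:
  assumes "cyclic_group G"
  shows "dense_solitary_subgroups G"
proof -
  obtain x where x: "x \<in> carrier G" and G: "carrier G = range (\<lambda>i::int. x [^] i)"
    using assms unfolding cyclic_group by blast
  have "carrier G = generate G {x}"
    unfolding generate_pow[OF x] G by blast
  with x show ?thesis by (rule cyclic_imp_dense)
qed

theorem theorem1p1:
  fixes G :: "('a, 'b) monoid_scheme"
  assumes "group G" and "finite (carrier G)"
  shows "dense_solitary_subgroups G \<longleftrightarrow>
    cyclic_group G \<or>
    (\<exists>m n r d p \<alpha> \<beta> :: nat.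
       ZM_triple m n r \<and> G \<cong> ZM m n r \<and>
       Factorial_Ring.prime m \<and> d = Pocklington.ord m r \<and> Factorial_Ring.prime d \<and>
       n = d ^ \<alpha> * p ^ \<beta> \<and> Factorial_Ring.prime p \<and> p \<noteq> d \<and> \<alpha> \<ge> 1 \<and> \<beta> \<in> {0, 1})"
proof -
  interpret finite_group G
    using assms by (simp add: finite_group_def finite_group_axioms_def)
  have "dense_group G" if "dense_solitary_subgroups G"
    using that by unfold_locales
  then show ?thesis
    using dense_group.noncyclic_imp_ZM[of G] cyclic_group_imp_dense ZM_imp_dense by blast
qed

end
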